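(* Let $a\geq 3$ and $d\geq 31a-3$ be integers such that $a$ divides $d+3$. Then for all $n\geq 1$, \[ \Delta_d^{(a,-,-)}(n) := q_d^{(a)}(n) - Q_d^{(a,-,-)}(n) \geq 0 . \]
   Context: For positive integers $a,d,n$, $q_d^{(a)}(n)$ denotes the number of partitions of $n$ in which every part is at least $a$ and any two parts differ by at least $d$. For $1\le b\le d+2$, $Q_d^{(b,-,-)}(n)$ denotes the number of partitions of $n$ into parts congruent to $\pm b \pmod{d+3}$, where the parts $b$ and $d+3-b$ are not allowed. *)

theory Defs
  imports "HOL-Library.Multiset" "HOL-Number_Theory.Cong"
begin

text \<open>
  Partitions are represented as finite multisets of positive natural numbers.
\<close>

definition partitions_of :: "nat \<Rightarrow> nat multiset set" where
  "partitions_of n = {P. (\<forall>x\<in>#P. 0 < x) \<and> sum_mset P = n}"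

text \<open>
  The cardinalities below are meaningful because there are only finitely many
  partitions of a given number.
\<close>

lemma finite_partitions_of: "finite (partitions_of n)"
proof -
  have "partitions_of n \<subseteq> mset ` {xs. set xs \<subseteq> {..n} \<and> length xs \<le> n}"
  proof
    fix P assume P: "P \<in> partitions_of n"
    obtain xs where xs: "P = mset xs" by (metis ex_mset)
    have pos: "\<forall>x\<in>set xs. 0 < x" and sum: "sum_list xs = n"
      using P by (auto simp: partitions_of_def xs sum_mset_sum_list)
    have "length xs \<le> sum_list xs"
      using pos by (induction xs) (auto simp: Suc_le_eq)
    moreover have "set xs \<subseteq> {..n}"
      using member_le_sum_list sum by auto
    ultimately show "P \<in> mset ` {xs. set xs \<subseteq> {..n} \<and> length xs \<le> n}"
      using xs sum by auto
  qed
  then show ?thesis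
    by (rule finite_subset) (simp add: finite_lists_length_le)
qed

text \<open>
  ``Any two parts'' means two parts at different positions of the partition,
  so one occurrence of \<open>x\<close> is removed before \<open>y\<close> is chosen; for
  \<open>d > 0\<close> this forbids repeated parts.
\<close>

definition parts_differ_by :: "nat \<Rightarrow> nat multiset \<Rightarrow> bool" where
  "parts_differ_by d P \<longleftrightarrow>
     (\<forall>x\<in>#P. \<forall>y\<in>#P - {#x#}. int d \<le> \<bar>int x - int y\<bar>)"

definition q :: "nat \<Rightarrow> nat \<Rightarrow> nat \<Rightarrow> nat" where
  "q d a n = card {P \<in> partitions_of n. (\<forall>x\<in>#P. a \<le> x) \<and> parts_differ_by d P}"

text \<open>
  \<open>Q_mm d b n\<close> is $Q_d^{(b,-,-)}(n)$, intended for \<open>1 \<le> b \<le> d + 2\<close>.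
\<close>

definition Q_mm :: "nat \<Rightarrow> nat \<Rightarrow> nat \<Rightarrow> nat" where
  "Q_mm d b n = card {P \<in> partitions_of n. \<forall>x\<in>#P.
     ([int x = int b] (mod int (d + 3)) \<or> [int x = - int b] (mod int (d + 3))) \<and>
     x \<noteq> b \<and> x \<noteq> d + 3 - b}"

definition Delta_mm :: "nat \<Rightarrow> nat \<Rightarrow> nat \<Rightarrow> int" where
  "Delta_mm d a n = int (q d a n) - int (Q_mm d a n)"

end

(* If a does not divide n, there is nothing to show. Otherwise write d + 3 = a m and divide by a:
   the partitions counted by Q become partitions into parts k m + 1 (k >= 1) and k m - 1 (k >= 2),
   and it suffices to inject them into partitions whose parts differ by at least some M >= m.
   Choose M with M + 1 = c_0 ... c_(r-1), all c_i >= 2, and put b_i = c_0 ... c_(i-1).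
   - Colour by colour, as in Bressoud's proof of Schur's theorem, a partition with fewer than c_i
     copies of each part b_i + M j is turned into a partition whose parts differ by at least M: a
     copy of b_i + M j adds M to the j largest parts and b_i to the next one if there is one, and
     otherwise becomes part of a new part. Residues modulo M are numbers in mixed radix whose
     digits record what was added, so this can be undone.
   - Since c_(r-1) b_(r-1) = 1 + M, multiplying a part b_i + M j by c_i leads to another part of
     this kind. Hence, by Glaisher's argument, the bound on the multiplicities may be dropped if
     only the parts that do not arise in this way are kept.
   - The part 1 remains available without restriction, so the part m + 1 can be traded for ones,
     and Andrews' comparison lemma only requires the i-th remaining part to be at most the i-th of
     the parts k m - 1, k m + 1 with k >= 2. This holds for M = 35 (m >= 31), M = 47 (m >= 36), and M = 32 w - 1 (3 m >= 2 M). *)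
theory Submission
  imports Defs
begin

section \<open>Residues modulo \<open>M\<close>, normalised to start at 1\<close>

text \<open>The residue of \<open>z\<close> modulo \<open>M\<close>, taken in \<open>{1..M}\<close>.\<close>

definition rho :: "nat \<Rightarrow> nat \<Rightarrow> nat" where
  "rho M z = Suc ((z - 1) mod M)"

text \<open>Writing a new mixed-radix digit: \<open>f\<close> is too small for the residue to wrap
  around, and the multiple of \<open>M\<close> is invisible.\<close>

lemma rho_add:
  assumes "0 < z" and "rho M z + f \<le> M"
  shows "rho M (z + f + M * t) = rho M z + f"
proof -
  have "(z + f + M * t - 1) mod M = ((z - 1) + f + M * t) mod M"
    using assms(1) by (simp add: algebra_simps Suc_leI)
  also have "\<dots> = ((z - 1) mod M + f) mod M"
    by (simp add: mod_simps)
  also have "\<dots> = (z - 1) mod M + f"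
    using assms(2) by (simp add: rho_def)
  finally show ?thesis by (simp add: rho_def)
qed

lemma rho_mult_add:
  assumes "0 < t" and "t \<le> M"
  shows "rho M (t + M * u) = t"
proof -
  have "t + M * u - 1 = (t - 1) + M * u" using assms by simp
  then have "(t + M * u - 1) mod M = ((t - 1) + M * u) mod M" by (simp only:)
  also have "\<dots> = t - 1"
    unfolding mod_mult_self2 using assms by (intro mod_less) simp
  finally show ?thesis using assms by (simp add: rho_def)
qed

section \<open>Parts of one colour: raising existing elements and inserting new ones\<close>

text \<open>A partition whose parts differ by at least \<open>M\<close> is stored as the multiset that remains after
  \<open>M * i\<close> has been subtracted from its \<open>i\<close>-th smallest part, \<open>i = 0, 1, \<dots>\<close>. Below, \<open>es\<close> lists
  the multiplicities of the parts \<open>b + M * j\<close> for consecutive \<open>j\<close>. If \<open>j\<close> is smaller than the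
  number of parts present, a copy of \<open>b + M * j\<close> adds \<open>M\<close> to the \<open>j\<close> largest elements and \<open>b\<close> to
  the next one (\<open>flag\<close>). Otherwise all \<open>e\<close> copies together are inserted as one new part; in terms
  of the stored multiset with \<open>K\<close> elements, the new element is their sum minus \<open>M * K\<close> (\<open>ins\<close>).\<close>

fun flag :: "nat \<Rightarrow> nat \<Rightarrow> nat list \<Rightarrow> nat list \<Rightarrow> nat list" where
  "flag M b (z # zs) (e # es) = (z + e * b + M * sum_list es) # flag M b zs es"
| "flag M b _ _ = []"

fun ins :: "nat \<Rightarrow> nat \<Rightarrow> nat \<Rightarrow> nat \<Rightarrow> nat list \<Rightarrow> nat multiset" where
  "ins M b K j [] = {#}"
| "ins M b K j (e # es) =
     (if e = 0 then ins M b K (Suc j) es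
      else add_mset (e * (b + M * j) - M * K) (ins M b (Suc K) (Suc j) es))"

fun wt :: "nat \<Rightarrow> nat \<Rightarrow> nat \<Rightarrow> nat list \<Rightarrow> nat" where
  "wt M b j [] = 0"
| "wt M b j (e # es) = e * (b + M * j) + wt M b (Suc j) es"

lemma wt_Suc: "wt M b (Suc j) es = wt M b j es + M * sum_list es"
  by (induction es arbitrary: j) (auto simp: algebra_simps)

lemma wt_append: "wt M b j (es @ fs) = wt M b j es + wt M b (j + length es) fs"
  by (induction es arbitrary: j) auto

lemma length_flag: "length zs = length es \<Longrightarrow> length (flag M b zs es) = length zs"
  by (induction M b zs es rule: flag.induct) auto

lemma sum_list_flag:
  "length zs = length es \<Longrightarrow> sum_list (flag M b zs es) = sum_list zs + wt M b 0 es"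
  by (induction M b zs es rule: flag.induct) (auto simp: wt_Suc algebra_simps)

text \<open>A multiplicity \<open>e\<close> contributes \<open>e * b\<close> at its own position and
  \<open>M * e\<close> at every earlier one; since \<open>b \<le> M\<close>, an earlier element
  never gains less than a later one. Sortedness lets \<open>attach_inj\<close> recover the list from
  its multiset.\<close>

lemma sorted_flag:
  assumes "length zs = length es" "sorted_wrt (\<ge>) zs" "b \<le> M"
  shows "sorted_wrt (\<ge>) (flag M b zs es)"
proof -
  have *: "x \<le> z + M * sum_list es"
    if "x \<in> set (flag M b zs es)" "\<forall>y\<in>set zs. y \<le> z" "length zs = length es" for x z zs es
    using that
  proof (induction zs arbitrary: es)
    case (Cons y zs)
    then obtain e es' where es: "es = e # es'" by (cases es) auto
    have IH: "x \<le> z + M * sum_list es'" if "x \<in> set (flag M b zs es')"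
      using Cons.IH[OF that] Cons.prems es by auto
    show ?case
    proof (cases "x \<in> set (flag M b zs es')")
      case True
      then show ?thesis using IH by (simp add: es add_mult_distrib2)
    next
      case False
      then have "x = y + e * b + M * sum_list es'" using Cons.prems es by auto
      moreover have "e * b \<le> M * e" using assms(3) by (simp add: mult.commute)
      moreover have "y \<le> z" using Cons.prems by simp
      ultimately show ?thesis unfolding es sum_list.Cons add_mult_distrib2 by linarith
    qed
  qed simp
  show ?thesis using assms(1,2)
  proof (induction zs arbitrary: es)
    case (Cons y zs)
    then obtain e es' where es: "es = e # es'" by (cases es) auto
    show ?case using Cons es *[of _ zs es' y] by (fastforce)
  qed simp
qed

text \<open>The residue keeps its old value below \<open>b\<close> and receives \<open>e\<close> as
  its next digit; \<open>b * c \<le> Suc M\<close> prevents an overflow. The nonzero old digits make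
  the residue indivisible by \<open>b\<close>, which tells these elements from the inserted
  ones.\<close>

lemma flag_rho:
  assumes "length zs = length es" "\<forall>z\<in>set zs. 0 < z \<and> rho M z < b"
    "\<forall>e\<in>set es. e < c" "b * c \<le> Suc M" "x \<in> set (flag M b zs es)"
  shows "0 < x \<and> rho M x < b * c \<and> \<not> b dvd rho M x"
proof -
  have aux: "rho M (z + e * b + M * s) = rho M z + e * b" "rho M z + e * b < b * c" 
    if "0 < z" "rho M z < b" "e < c" for z e s
  proof -
    have "rho M z + e * b < b * Suc e" using that by simp
    also have "\<dots> \<le> b * c" using that by (intro mult_le_mono2) auto
    finally show l: "rho M z + e * b < b * c" .
    then show "rho M (z + e * b + M * s) = rho M z + e * b"
      using assms(4) that by (intro rho_add) auto
  qed
  show ?thesis using assms(1,2,3,5)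
  proof (induction zs arbitrary: es)
    case (Cons y zs)
    then obtain e es' where es: "es = e # es'" by (cases es) auto
    show ?case
    proof (cases "x = y + e * b + M * sum_list es'")
      case True
      have "\<not> b dvd rho M y + e * b"
      proof
        assume "b dvd rho M y + e * b"
        then have "b dvd rho M y" by simp
        moreover have "0 < rho M y" by (simp add: rho_def)
        ultimately show False using Cons.prems(2) by (auto dest: dvd_imp_le)
      qed
      then show ?thesis using aux(1)[of y e "sum_list es'"] aux(2)[of y e] Cons.prems True es by auto
    next
      case False
      then show ?thesis using Cons es by auto
    qed
  qed simp
qed

text \<open>The multiplicity at a position is its residue divided by \<open>b\<close>. The tail is
  decoded first, because the head also contains \<open>M\<close> times the sum of the later
  multiplicities.\<close>

lemma flag_inj:
  assumes "length zs = length es" "\<forall>z\<in>set zs. 0 < z \<and> rho M z < b" "\<forall>e\<in>set es. e < c"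
    "length zs' = length es'" "\<forall>z\<in>set zs'. 0 < z \<and> rho M z < b" "\<forall>e\<in>set es'. e < c"
    "b * c \<le> Suc M" "flag M b zs es = flag M b zs' es'"
  shows "zs = zs' \<and> es = es'"
proof -
  have aux: "rho M (z + e * b + M * s) = rho M z + e * b" "(rho M z + e * b) div b = e" 
    if "0 < z" "rho M z < b" "e < c" for z e s
  proof -
    have "rho M z + e * b < b * Suc e" using that by simp
    also have "\<dots> \<le> b * c" using that by (intro mult_le_mono2) auto
    finally have l: "rho M z + e * b < b * c" .
    then show "rho M (z + e * b + M * s) = rho M z + e * b"
      using assms(7) that by (intro rho_add) auto
    show "(rho M z + e * b) div b = e" using that by simp
  qed
  show ?thesis using assms(1-6,8)
  proof (induction zs arbitrary: es zs' es')
    case Nil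
    then show ?case by (cases zs'; cases es') auto
  next
    case (Cons y zs)
    then obtain e fs where es: "es = e # fs" by (cases es) auto
    then obtain y' ws where zs': "zs' = y' # ws" using Cons.prems by (cases zs') auto
    then obtain e' fs' where es': "es' = e' # fs'" using Cons.prems by (cases es') auto
    have t: "zs = ws \<and> fs = fs'"
      by (rule Cons.IH) (use Cons.prems es zs' es' in auto)
    have h: "y + e * b + M * sum_list fs = y' + e' * b + M * sum_list fs"
      using Cons.prems es zs' es' t by simp
    have "rho M y + e * b = rho M y' + e' * b"
      using aux(1)[of y e "sum_list fs"] aux(1)[of y' e' "sum_list fs"] h Cons.prems es zs' es'
      by simp
    then have "e = e'" using aux(2)[of y e] aux(2)[of y' e'] Cons.prems es zs' es' by simp
    then show ?case using h t es zs' es' by simp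
  qed
qed

definition nz :: "nat list \<Rightarrow> nat" where
  "nz es = length (filter (\<lambda>e. 0 < e) es)"

lemma size_ins: "size (ins M b K j es) = nz es"
  by (induction M b K j es rule: ins.induct) (auto simp: nz_def)

lemma nz_le: "nz es \<le> length es"
  by (simp add: nz_def)

lemma ins_append:
  "ins M b K j (es @ fs) = ins M b K j es + ins M b (K + nz es) (j + length es) fs"
  by (induction es arbitrary: K j) (auto simp: nz_def)

text \<open>Successive insertions lose \<open>M * K\<close>, \<open>M * (K + 1)\<close> and so on,
  which add up to the difference of the two binomial terms. By \<open>K \<le> j\<close> the
  subtraction on natural numbers never truncates.\<close>

lemma sum_ins:
  assumes "K \<le> j"
  shows "sum_mset (ins M b K j es) + M * (K + nz es choose 2) = wt M b j es + M * (K choose 2)"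
  using assms
proof (induction es arbitrary: K j)
  case Nil
  then show ?case by (simp add: nz_def)
next
  case (Cons e es)
  show ?case
  proof (cases "e = 0")
    case True
    then show ?thesis using Cons.IH[of K "Suc j"] Cons.prems by (simp add: nz_def)
  next
    case False
    have "M * K \<le> e * (b + M * j)"
    proof -
      have "M * K \<le> M * j" using Cons.prems by simp
      also have "\<dots> \<le> e * (b + M * j)" using False by (cases e) auto
      finally show ?thesis .
    qed
    then show ?thesis using Cons.IH[of "Suc K" "Suc j"] Cons.prems False
      by (simp add: nz_def numeral_2_eq_2 algebra_simps)
  qed
qed

text \<open>The final inequality is violated by any element of type \<open>t \<ge> 2\<close> that is inserted at the next
  position, which is how the last insertion is recognised in \<open>ins_inj\<close>.\<close>

lemma ins_elem:
  assumes "K \<le> j" "w \<in># ins M b K j es" "\<forall>e\<in>set es. e < c"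
  shows "\<exists>t u. 0 < t \<and> t < c \<and> w = t * b + M * u \<and> u + (K + nz es) + t \<le> t * (j + length es) + 1"
  using assms
proof (induction es arbitrary: K j)
  case (Cons e es)
  show ?case
  proof (cases "e \<noteq> 0 \<and> w = e * (b + M * j) - M * K")
    case True
    have Kj: "K \<le> e * j" using Cons.prems(1) True by (cases e) auto
    have "w = e * b + M * (e * j - K)"
    proof -
      have "M * (e * j) = e * M * j" by simp
      moreover have "M * K \<le> M * (e * j)" using Kj by simp
      ultimately show ?thesis using True by (simp add: algebra_simps)
    qed
    moreover have "(e * j - K) + (K + nz (e # es)) + e \<le> e * (j + length (e # es)) + 1"
    proof -
      have "nz es \<le> e * length es"
        using nz_le[of es] True by (cases e) auto
      then show ?thesis using Kj True by (simp add: nz_def algebra_simps)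
    qed
    ultimately show ?thesis using True Cons.prems(3) by (metis list.set_intros(1) neq0_conv)
  next
    case False
    show ?thesis
    proof (cases "e = 0")
      case True
      have "\<exists>t u. 0 < t \<and> t < c \<and> w = t * b + M * u \<and>
          u + (K + nz es) + t \<le> t * (Suc j + length es) + 1"
        using Cons.IH[of K "Suc j"] Cons.prems True by auto
      then show ?thesis using True by (simp add: nz_def)
    next
      case False': False
      have "\<exists>t u. 0 < t \<and> t < c \<and> w = t * b + M * u \<and>
          u + (Suc K + nz es) + t \<le> t * (Suc j + length es) + 1"
        using Cons.IH[of "Suc K" "Suc j"] Cons.prems False False' by auto
      then show ?thesis using False' by (simp add: nz_def)
    qed
  qed
qed simp

text \<open>An inserted element has residue \<open>t * b\<close>, with \<open>t\<close> the
  multiplicity it came from: the new digit is \<open>t\<close> and all older digits vanish. Compare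
  \<open>flag_rho\<close>.\<close>

lemma ins_rho:
  assumes "K \<le> j" "w \<in># ins M b K j es" "\<forall>e\<in>set es. e < c" "0 < b" "b * c \<le> Suc M"
  shows "0 < w \<and> rho M w < b * c \<and> b dvd rho M w"
proof -
  obtain t u where tu: "0 < t" "t < c" "w = t * b + M * u" using ins_elem[OF assms(1-3)] by blast
  have "t * b < b * c" using tu assms(4) by (simp add: mult.commute)
  then have "rho M w = t * b"
    using tu(1) assms(4,5) \<open>t * b < b * c\<close>
    by (intro rho_mult_add[of "t * b" M u, folded tu(3)]) (simp, linarith)
  then show ?thesis using tu \<open>t * b < b * c\<close> assms(4) by auto
qed

text \<open>The multiplicities are recovered from the last one backwards. If the last ones were
  \<open>e < e'\<close>, the element \<open>w\<close> made from \<open>e'\<close> would also occur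
  in the other multiset, where it can be neither the last insertion nor, by the inequality of
  \<open>ins_elem\<close>, an earlier one.\<close>

lemma ins_inj:
  assumes "K \<le> j" "length es = length es'" "\<forall>e\<in>set es. e < c" "\<forall>e\<in>set es'. e < c"
    "0 < b" "b * c \<le> Suc M" "ins M b K j es = ins M b K j es'"
  shows "es = es'"
  using assms(2,3,4,7)
proof (induction es arbitrary: es' rule: rev_induct)
  case Nil
  then show ?case by simp
next
  case (snoc e es)
  obtain e' fs where es': "es' = fs @ [e']"
    using snoc.prems(1) by (metis length_0_conv length_append_singleton nat.distinct(1) rev_exhaust)
  have main: "\<not> (e < e' \<and> ins M b K j (es @ [e]) = ins M b K j (fs @ [e']))"
    if l: "length es = length fs" and c: "\<forall>e\<in>set es. e < c" "e' < c" for es fs :: "nat list" and e e'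
  proof
    assume a: "e < e' \<and> ins M b K j (es @ [e]) = ins M b K j (fs @ [e'])"
    define J where "J = j + length es"
    define w where "w = e' * (b + M * J) - M * (K + nz fs)"
    have s: "nz (es @ [e]) = nz (fs @ [e'])" using a by (metis size_ins)
    have KJ: "K + nz fs \<le> e' * J"
    proof -
      have "K + nz fs \<le> J" using assms(1) nz_le[of fs] l by (simp add: J_def)
      also have "\<dots> \<le> e' * J" using a by (cases e') auto
      finally show ?thesis .
    qed
    have weq: "w = e' * b + M * (e' * J - (K + nz fs))"
      using KJ mult_le_mono2[OF KJ, of M] by (simp add: w_def algebra_simps)
    have "w \<in># ins M b K j (fs @ [e'])"
      using a l by (auto simp: ins_append w_def J_def)
    then have win: "w \<in># ins M b K j (es @ [e])" using a by simp
    \<comment> \<open>For nonzero \<open>e\<close>, both last insertions take place at the same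
      size, so the smaller multiplicity yields the smaller element.\<close>
    have "w \<noteq> e * (b + M * J) - M * (K + nz es)" if "e \<noteq> 0"
    proof
      assume "w = e * (b + M * J) - M * (K + nz es)"
      moreover have n: "nz es = nz fs" using s that a by (simp add: nz_def)
      moreover have "e * (b + M * J) < e' * (b + M * J)" using a assms(5) by simp
      moreover have "M * (K + nz fs) < e' * (b + M * J)"
      proof -
        have "M * (K + nz fs) \<le> M * (e' * J)" using KJ by (rule mult_le_mono2)
        also have "\<dots> < e' * (b + M * J)" using a assms(5) by (simp add: algebra_simps)
        finally show ?thesis .
      qed
      ultimately show False unfolding w_def n by linarith
    qed
    then have "w \<in># ins M b K j es"
      using win by (auto simp: ins_append J_def split: if_splits)
    from ins_elem[OF assms(1) this c(1)] obtain t u where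
      t: "0 < t" "t < c" "w = t * b + M * u" "u + (K + nz es) + t \<le> t * J + 1"
      by (auto simp: J_def)
    have e'pos: "0 < e'" using a by auto
    have b: "x * b \<le> M \<and> 0 < x * b" if "0 < x" "x < c" for x
    proof -
      have "x * b < b * c" using that assms(5) by (simp add: mult.commute)
      then have "x * b \<le> M" using assms(6) by linarith
      then show ?thesis using that assms(5) by simp
    qed
    have "t * b = e' * b"
      using rho_mult_add[of "t * b" M u] rho_mult_add[of "e' * b" M "e' * J - (K + nz fs)"]
        b[OF t(1,2)] b[OF e'pos c(2)] t(3) weq by simp
    then have te: "t = e'" using assms(5) by simp
    have "0 < M" using b[OF t(1,2)] by linarith
    then have "u = e' * J - (K + nz fs)" using t(3) weq te by simp
    then have "nz es + e' \<le> nz fs + 1" using t(4) KJ unfolding te by linarith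
    \<comment> \<open>By \<open>s\<close>, \<open>nz es\<close> equals \<open>nz fs\<close> if
      \<open>0 < e\<close> and \<open>nz fs + 1\<close> if \<open>e = 0\<close>. So
      \<open>e' \<le> 1\<close> or \<open>e' = 0\<close> follows, both against
      \<open>e < e'\<close>.\<close>
    then show False using s a by (auto simp: nz_def split: if_splits)
  qed
  have "e = e'"
  proof (rule linorder_cases[of e e'])
    assume "e < e'" then show ?thesis using main[of es fs e' e] snoc.prems es' by auto
  next
    assume "e' < e" then show ?thesis using main[of fs es e e'] snoc.prems es' by auto
  qed
  moreover have "es = fs"
  proof (rule snoc.IH)
    show "ins M b K j es = ins M b K j fs"
    proof -
      have "nz es = nz fs"
        using arg_cong[OF snoc.prems(4), of size] \<open>e = e'\<close> es' by (simp add: size_ins nz_def)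
      then show ?thesis using snoc.prems es' \<open>e = e'\<close> by (simp add: ins_append)
    qed
  qed (use snoc.prems es' in auto)
  ultimately show ?case using es' by simp
qed

section \<open>Stored partitions and the treatment of one colour\<close>

text \<open>The sum of the partition that \<open>Z\<close> stands for: the binomial term restores
  the multiples \<open>M * i\<close> that were subtracted from its parts.\<close>

definition weight :: "nat \<Rightarrow> nat multiset \<Rightarrow> nat" where
  "weight M Z = sum_mset Z + M * (size Z choose 2)"

text \<open>The bound \<open>b\<close> says that only digits of earlier colours have been written.
  For \<open>b = 1\<close> only the empty multiset is left; for \<open>b = Suc M\<close> with
  positive \<open>M\<close> every multiset of positive numbers of that weight qualifies.\<close>

definition gapless :: "nat \<Rightarrow> nat \<Rightarrow> nat \<Rightarrow> nat multiset set" where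
  "gapless M b n = {Z. (\<forall>z\<in>#Z. 0 < z \<and> rho M z < b) \<and> weight M Z = n}"

lemma finite_gapless: "finite (gapless M b n)"
proof (rule finite_subset)
  show "gapless M b n \<subseteq> (\<Union>k\<le>n. partitions_of k)"
    by (auto simp: gapless_def weight_def partitions_of_def)
qed (simp add: finite_partitions_of)

lemma size_le_sum_mset:
  fixes Z :: "nat multiset"
  assumes "\<forall>z\<in>#Z. 0 < z"
  shows "size Z \<le> sum_mset Z"
  using assms by (induction Z) auto

text \<open>A finite list needs a length \<open>N\<close>; any \<open>N\<close> above all parts of
  \<open>Y\<close> also exceeds every index \<open>j\<close> that occurs.\<close>

definition mults :: "nat \<Rightarrow> nat \<Rightarrow> nat \<Rightarrow> nat multiset \<Rightarrow> nat list" where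
  "mults M b N Y = map (\<lambda>j. count Y (b + M * j)) [0..<N]"

lemma wt_map: "wt M b 0 (map f [0..<N]) = (\<Sum>j<N. f j * (b + M * j))"
  by (induction N) (auto simp: wt_append)

lemma wt_mults:
  assumes "\<forall>y\<in>#Y. y mod M = b \<and> y < N" "b < M"
  shows "wt M b 0 (mults M b N Y) = sum_mset Y"
proof -
  have "(\<Sum>j<N. count Y (b + M * j) * (b + M * j)) = sum_mset Y"
    using assms(1)
  proof (induction Y)
    case (add y Y)
    define j0 where "j0 = y div M"
    have y: "y = b + M * j0" "y < N" using add.prems by (auto simp: j0_def)
    have "j0 < N" using y(2) unfolding j0_def by (rule le_less_trans[OF div_le_dividend])
    have "(\<Sum>j<N. count (add_mset y Y) (b + M * j) * (b + M * j)) =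
        (\<Sum>j<N. count Y (b + M * j) * (b + M * j) + (if j = j0 then y else 0))"
      using assms(2) by (intro sum.cong) (auto simp: y)
    also have "\<dots> = sum_mset Y + y" using add \<open>j0 < N\<close> by (simp add: sum.distrib)
    finally show ?case by simp
  qed simp
  then show ?thesis by (simp add: mults_def wt_map)
qed

lemma mults_inj:
  assumes "\<forall>y\<in>#Y. y mod M = b \<and> y < N" "\<forall>y\<in>#Y'. y mod M = b \<and> y < N" "0 < M"
    "mults M b N Y = mults M b N Y'"
  shows "Y = Y'"
proof (rule multiset_eqI)
  fix x
  show "count Y x = count Y' x"
  proof (cases "x mod M = b \<and> x < N")
    case True
    then have x: "x = b + M * (x div M)" by auto
    have "x div M < N" using True by (meson div_le_dividend le_less_trans)
    then have "mults M b N Y ! (x div M) = count Y x" "mults M b N Y' ! (x div M) = count Y' x"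
      using x by (simp_all add: mults_def)
    then show ?thesis using assms(4) by simp
  next
    case False
    then have "x \<notin># Y" "x \<notin># Y'" using assms(1,2) by auto
    then show ?thesis by (simp add: count_eq_zero_iff[symmetric])
  qed
qed

definition attach :: "nat \<Rightarrow> nat \<Rightarrow> nat \<Rightarrow> nat multiset \<Rightarrow> nat multiset \<Rightarrow> nat multiset" where
  "attach M b N Z Y =
     mset (flag M b (rev (sorted_list_of_multiset Z)) (take (size Z) (mults M b N Y))) +
     ins M b (size Z) (size Z) (drop (size Z) (mults M b N Y))"

lemma length_sorted_list_of_multiset: "length (sorted_list_of_multiset Z) = size Z"
  by (metis mset_sorted_list_of_multiset size_mset)

text \<open>The sizes match by \<open>sum_list_flag\<close> for the indices below
  \<open>size Z\<close> and by \<open>sum_ins\<close> for the others; the residues gain one digit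
  below \<open>c\<close>.\<close>

lemma attach_gapless:
  assumes "\<forall>z\<in>#Z. 0 < z \<and> rho M z < b" "\<forall>y\<in>#Y. y mod M = b \<and> y < N \<and> count Y y < c"
    "0 < b" "b < M" "0 < c" "b * c \<le> Suc M" "size Z \<le> N"
  shows "attach M b N Z Y \<in> gapless M (b * c) (weight M Z + sum_mset Y)"
proof -
  define zs where "zs = rev (sorted_list_of_multiset Z)"
  define es where "es = mults M b N Y"
  define k where "k = size Z"
  have len: "length zs = length (take k es)"
    using assms(7) by (simp add: zs_def es_def k_def mults_def length_sorted_list_of_multiset)
  have cY: "count Y x < c" for x
    using assms(2,5) by (cases "x \<in># Y") (auto simp: not_in_iff)
  have ec: "\<forall>e\<in>set es. e < c" using cY by (auto simp: es_def mults_def)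
  have zs: "\<forall>z\<in>set zs. 0 < z \<and> rho M z < b" using assms(1) by (simp add: zs_def)
  have A: "attach M b N Z Y = mset (flag M b zs (take k es)) + ins M b k k (drop k es)"
    by (simp add: attach_def zs_def es_def k_def)
  have "0 < x \<and> rho M x < b * c" if "x \<in># attach M b N Z Y" for x
  proof -
    have "x \<in> set (flag M b zs (take k es)) \<or> x \<in># ins M b k k (drop k es)"
      using that by (simp add: A)
    then show ?thesis
    proof
      assume "x \<in> set (flag M b zs (take k es))"
      then show ?thesis using flag_rho[OF len zs _ assms(6)] ec by (metis in_set_takeD)
    next
      assume "x \<in># ins M b k k (drop k es)"
      then show ?thesis using ins_rho[OF _ _ _ assms(3,6)] ec by (metis in_set_dropD order_refl)
    qed
  qed
  moreover have "weight M (attach M b N Z Y) = weight M Z + sum_mset Y"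
  proof -
    have "sum_list zs = sum_mset Z" by (simp add: zs_def flip: sum_mset_sum_list)
    have "length zs = k" by (simp add: zs_def k_def length_sorted_list_of_multiset)
    have "wt M b 0 es = wt M b 0 (take k es @ drop k es)" by simp
    also have "\<dots> = wt M b 0 (take k es) + wt M b k (drop k es)"
      unfolding wt_append using len \<open>length zs = k\<close> by simp
    finally have "wt M b 0 (take k es) + wt M b k (drop k es) = sum_mset Y"
      using wt_mults[of Y M b N] assms(2,4) by (simp add: es_def)
    moreover have "weight M (attach M b N Z Y) = sum_mset Z + wt M b 0 (take k es) +
        (sum_mset (ins M b k k (drop k es)) + M * (k + nz (drop k es) choose 2))"
      using sum_list_flag[OF len, of M b] length_flag[OF len, of M b] \<open>length zs = k\<close>
      by (simp add: weight_def A size_ins sum_mset_sum_list \<open>sum_list zs = sum_mset Z\<close>)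
    ultimately show ?thesis
      by (simp add: sum_ins weight_def k_def)
  qed
  ultimately show ?thesis by (simp add: gapless_def)
qed

lemma sorted_ge_unique:
  fixes xs ys :: "nat list"
  assumes "sorted_wrt (\<ge>) xs" "sorted_wrt (\<ge>) ys" "mset xs = mset ys"
  shows "xs = ys"
proof -
  have "sorted (rev xs)" "sorted (rev ys)" using assms by (simp_all add: sorted_wrt_rev)
  then have "rev xs = rev ys" using assms(3) by (metis mset_rev properties_for_sort)
  then show ?thesis by simp
qed

text \<open>Divisibility of the residue by \<open>b\<close> separates the result into raised and
  inserted elements. The number of raised ones is \<open>size Z\<close>, and \<open>flag_inj\<close>
  and \<open>ins_inj\<close> decode the two halves of the list of multiplicities.\<close>

lemma attach_inj:
  assumes "\<forall>z\<in>#Z. 0 < z \<and> rho M z < b" "\<forall>y\<in>#Y. y mod M = b \<and> y < N \<and> count Y y < c"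
    "\<forall>z\<in>#Z'. 0 < z \<and> rho M z < b" "\<forall>y\<in>#Y'. y mod M = b \<and> y < N \<and> count Y' y < c"
    "0 < b" "b < M" "0 < c" "b * c \<le> Suc M" "size Z \<le> N" "size Z' \<le> N"
    "attach M b N Z Y = attach M b N Z' Y'"
  shows "Z = Z' \<and> Y = Y'"
proof -
  define F where "F Z Y = flag M b (rev (sorted_list_of_multiset Z)) (take (size Z) (mults M b N Y))"
    for Z Y :: "nat multiset"
  define G where "G Z Y = ins M b (size Z) (size Z) (drop (size Z) (mults M b N Y))"
    for Z Y :: "nat multiset"
  have *: "mset (F Z Y) = filter_mset (\<lambda>x. \<not> b dvd rho M x) (attach M b N Z Y)"
     "G Z Y = filter_mset (\<lambda>x. b dvd rho M x) (attach M b N Z Y)"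
     "length (F Z Y) = size Z" "sorted_wrt (\<ge>) (F Z Y)"
     "length (mults M b N Y) = N" "\<forall>e\<in>set (mults M b N Y). e < c"
    if Z: "\<forall>z\<in>#Z. 0 < z \<and> rho M z < b" and Y: "\<forall>y\<in>#Y. y mod M = b \<and> y < N \<and> count Y y < c"
      and s: "size Z \<le> N" for Z Y
  proof -
    define zs where "zs = rev (sorted_list_of_multiset Z)"
    define es where "es = mults M b N Y"
    define k where "k = size Z"
    have "count Y x < c" for x
      using Y assms(7) by (cases "x \<in># Y") (auto simp: not_in_iff)
    then have ec: "\<forall>e\<in>set es. e < c" by (auto simp: es_def mults_def)
    then show "\<forall>e\<in>set (mults M b N Y). e < c" by (simp add: es_def)
    show "length (mults M b N Y) = N" by (simp add: mults_def)
    have len: "length zs = length (take k es)"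
      using s by (simp add: zs_def es_def k_def mults_def length_sorted_list_of_multiset)
    have zs: "\<forall>z\<in>set zs. 0 < z \<and> rho M z < b" using Z by (simp add: zs_def)
    have zk: "length zs = k" by (simp add: zs_def k_def length_sorted_list_of_multiset)
    have A: "attach M b N Z Y = mset (F Z Y) + G Z Y"
      by (simp add: attach_def F_def G_def)
    have f: "F Z Y = flag M b zs (take k es)" and g: "G Z Y = ins M b k k (drop k es)"
      by (simp_all add: F_def G_def zs_def es_def k_def)
    have 1: "\<not> b dvd rho M x" if "x \<in> set (F Z Y)" for x
      using flag_rho[OF len zs _ assms(8)] ec that f by (metis in_set_takeD)
    have 2: "b dvd rho M x" if "x \<in># G Z Y" for x
      using ins_rho[OF _ _ _ assms(5,8)] ec that g by (metis in_set_dropD order_refl)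
    have "filter_mset (\<lambda>x. \<not> b dvd rho M x) (mset (F Z Y)) = mset (F Z Y)"
      "filter_mset (\<lambda>x. \<not> b dvd rho M x) (G Z Y) = {#}"
      "filter_mset (\<lambda>x. b dvd rho M x) (mset (F Z Y)) = {#}"
      "filter_mset (\<lambda>x. b dvd rho M x) (G Z Y) = G Z Y"
      using 1 2 by (auto simp: filter_mset_eq_conv)
    then show "mset (F Z Y) = filter_mset (\<lambda>x. \<not> b dvd rho M x) (attach M b N Z Y)"
     "G Z Y = filter_mset (\<lambda>x. b dvd rho M x) (attach M b N Z Y)" by (simp_all add: A)
    show "length (F Z Y) = size Z" using length_flag[OF len] f zk k_def by simp
    have "sorted_wrt (\<ge>) zs" by (simp add: zs_def sorted_wrt_rev)
    then show "sorted_wrt (\<ge>) (F Z Y)" using sorted_flag[OF len] assms(6) f by simp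
  qed
  note P = *[OF assms(1,2,9)] and P' = *[OF assms(3,4,10)]
  have F: "F Z Y = F Z' Y'"
    using sorted_ge_unique P(1,4) P'(1,4) assms(11) by simp
  then have k: "size Z = size Z'" using P(3) P'(3) by simp
  have G: "G Z Y = G Z' Y'" using P(2) P'(2) assms(11) by simp
  have Ft: "rev (sorted_list_of_multiset Z) = rev (sorted_list_of_multiset Z') \<and>
      take (size Z) (mults M b N Y) = take (size Z) (mults M b N Y')"
    by (rule flag_inj[where c = c and M = M and b = b])
      (use assms P P' k F in \<open>auto simp: F_def length_sorted_list_of_multiset dest: in_set_takeD\<close>)
  have Gd: "drop (size Z) (mults M b N Y) = drop (size Z) (mults M b N Y')"
    by (rule ins_inj[where c = c and M = M and b = b and K = "size Z" and j = "size Z"])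
      (use assms P P' k G in \<open>auto simp: G_def dest: in_set_dropD\<close>)
  have "mults M b N Y = mults M b N Y'"
    using Ft Gd by (metis append_take_drop_id)
  then have "Y = Y'" using assms by (intro mults_inj[of Y M b N Y']) auto
  moreover have "Z = Z'" using Ft by (metis mset_sorted_list_of_multiset rev_rev_ident)
  ultimately show ?thesis by simp
qed

section \<open>Iteration over all colours\<close>

text \<open>\<open>rad M b [c\<^sub>0, c\<^sub>1, \<dots>] y\<close> is \<open>c\<^sub>i\<close> if \<open>y\<close> is congruent to \<open>b * c\<^sub>0 * \<dots> * c\<^sub>i\<^sub>-\<^sub>1\<close>
  modulo \<open>M\<close>, and 0 if \<open>y\<close> is not an admissible part.\<close>

fun rad :: "nat \<Rightarrow> nat \<Rightarrow> nat list \<Rightarrow> nat \<Rightarrow> nat" where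
  "rad M b [] y = 0"
| "rad M b (c # cs) y = (if y mod M = b then c else rad M (b * c) cs y)"

text \<open>An intermediate stage: \<open>Z\<close> has absorbed the colours before
  \<open>b\<close>, and \<open>Y\<close> holds the parts of the colours still to come.\<close>

definition coloured :: "nat \<Rightarrow> nat \<Rightarrow> nat list \<Rightarrow> nat \<Rightarrow> (nat multiset \<times> nat multiset) set" where
  "coloured M b cs n = {(Z, Y). (\<forall>z\<in>#Z. 0 < z \<and> rho M z < b) \<and>
     (\<forall>y\<in>#Y. count Y y < rad M b cs y) \<and> weight M Z + sum_mset Y = n}"

text \<open>Each induction step attaches the parts congruent to \<open>b\<close> and passes from
  \<open>b\<close> to \<open>b * c\<close>, injectively. When no colour is left,
  \<open>b = Suc M\<close> and \<open>Y\<close> is empty.\<close>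

lemma card_coloured_le:
  assumes "b * prod_list cs = Suc M" "\<forall>c\<in>set cs. 2 \<le> c" "0 < b" "2 \<le> M"
  shows "finite (coloured M b cs n) \<and> card (coloured M b cs n) \<le> card (gapless M (Suc M) n)"
  using assms(1-3)
proof (induction cs arbitrary: b)
  case Nil
  have *: "Y = {#}" if "\<forall>y\<in>#Y. count Y y < rad M b [] y" for Y
    using that by (cases Y) auto
  have i: "inj_on fst (coloured M b [] n)" "fst ` coloured M b [] n \<subseteq> gapless M (Suc M) n"
    using Nil by (auto simp: coloured_def gapless_def inj_on_def dest!: *)
  show ?case
    using inj_on_finite[OF i finite_gapless] card_inj_on_le[OF i finite_gapless] by simp
next
  case (Cons c cs)
  have "prod_list cs \<noteq> 0" using Cons.prems(1) by (intro notI) simp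
  then have c: "2 \<le> c" "0 < prod_list cs" using Cons.prems(2) by simp_all
  have "b * c * 1 \<le> b * c * prod_list cs" using c by (intro mult_le_mono2) simp
  then have bc: "b * c \<le> Suc M"
    using Cons.prems(1) by (simp only: mult_1_right prod_list.Cons mult.assoc)
  moreover have "b * 2 \<le> b * c" using c by simp
  ultimately have b: "b < M" using assms(4) by linarith
  have IH: "finite (coloured M (b * c) cs n)"
    "card (coloured M (b * c) cs n) \<le> card (gapless M (Suc M) n)"
    using Cons.IH[of "b * c"] Cons.prems c by (auto simp: mult.assoc)
  \<comment> \<open>The total is \<open>n\<close>, so \<open>Suc n\<close> exceeds every part of
    \<open>Y\<close> and the size of \<open>Z\<close>.\<close>
  define N where "N = Suc n"
  define h where "h = (\<lambda>(Z, Y). (attach M b N Z {#y \<in># Y. y mod M = b#}, {#y \<in># Y. y mod M \<noteq> b#}))"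
  have split: "Y = {#y \<in># Y. y mod M = b#} + {#y \<in># Y. y mod M \<noteq> b#}" for Y
    by (rule multiset_partition)
  have D: "\<forall>z\<in>#Z. 0 < z \<and> rho M z < b"
    "\<forall>y\<in>#{#y \<in># Y. y mod M = b#}. y mod M = b \<and> y < N \<and> count {#y \<in># Y. y mod M = b#} y < c"
    "size Z \<le> N"
    if "(Z, Y) \<in> coloured M b (c # cs) n" for Z Y
  proof -
    show 1: "\<forall>z\<in>#Z. 0 < z \<and> rho M z < b" using that by (simp add: coloured_def)
    have Y: "sum_mset Z + sum_mset Y \<le> n" using that by (auto simp: coloured_def weight_def)
    show "size Z \<le> N" using size_le_sum_mset[of Z] 1 Y by (simp add: N_def)
    have "y < N" if "y \<in># Y" for y
      using that Y by (auto simp: N_def dest!: multi_member_split)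
    then show "\<forall>y\<in>#{#y \<in># Y. y mod M = b#}. y mod M = b \<and> y < N \<and>
        count {#y \<in># Y. y mod M = b#} y < c"
      using that by (fastforce simp: coloured_def)
  qed
  have "inj_on h (coloured M b (c # cs) n)"
  proof (rule inj_onI)
    fix p p' assume p: "p \<in> coloured M b (c # cs) n" "p' \<in> coloured M b (c # cs) n" "h p = h p'"
    obtain Z Y Z' Y' where [simp]: "p = (Z, Y)" "p' = (Z', Y')" by (cases p; cases p')
    have "attach M b N Z {#y \<in># Y. y mod M = b#} = attach M b N Z' {#y \<in># Y'. y mod M = b#}"
      and o: "{#y \<in># Y. y mod M \<noteq> b#} = {#y \<in># Y'. y mod M \<noteq> b#}"
      using p(3) by (simp_all add: h_def)
    then have "Z = Z' \<and> {#y \<in># Y. y mod M = b#} = {#y \<in># Y'. y mod M = b#}"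
      using D[of Z Y] D[of Z' Y'] p(1,2) Cons.prems(3) b c bc
      by (intro attach_inj[of Z M b _ N c]) auto
    then show "p = p'" using o split by (metis \<open>p = (Z, Y)\<close> \<open>p' = (Z', Y')\<close>)
  qed
  moreover have "h ` coloured M b (c # cs) n \<subseteq> coloured M (b * c) cs n"
  proof
    fix r assume "r \<in> h ` coloured M b (c # cs) n"
    then obtain Z Y where r: "r = h (Z, Y)" and ZY: "(Z, Y) \<in> coloured M b (c # cs) n" by auto
    have "attach M b N Z {#y \<in># Y. y mod M = b#} \<in>
        gapless M (b * c) (weight M Z + sum_mset {#y \<in># Y. y mod M = b#})"
      using D[OF ZY] Cons.prems(3) b c bc by (intro attach_gapless) auto
    moreover have "weight M Z + sum_mset {#y \<in># Y. y mod M = b#} + sum_mset {#y \<in># Y. y mod M \<noteq> b#} = n"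
    proof -
      have "sum_mset Y = sum_mset {#y \<in># Y. y mod M = b#} + sum_mset {#y \<in># Y. y mod M \<noteq> b#}"
        using split[of Y] by (metis sum_mset.union)
      then show ?thesis using ZY by (simp add: coloured_def)
    qed
    moreover have "\<forall>y\<in>#{#y \<in># Y. y mod M \<noteq> b#}. count {#y \<in># Y. y mod M \<noteq> b#} y < rad M (b * c) cs y"
      using ZY by (auto simp: coloured_def split: if_splits)
    ultimately show "r \<in> coloured M (b * c) cs n"
      by (simp add: r h_def coloured_def gapless_def)
  qed
  ultimately show ?case
    using IH by (meson card_inj_on_le inj_on_finite le_trans)
qed

section \<open>Glaisher's carrying argument\<close>

text \<open>The part from which \<open>y\<close> arises by one carry; it is unique when carrying is
  injective, as in \<open>expand_mult\<close>.\<close>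

definition previous :: "(nat \<Rightarrow> nat) \<Rightarrow> nat \<Rightarrow> nat" where
  "previous c y = (SOME x. c x \<noteq> 0 \<and> x < y \<and> y = c x * x)"

text \<open>Undoes carries until a part is reached that arises from no smaller one. The condition
  \<open>x < y\<close> secures termination.\<close>

function expand :: "(nat \<Rightarrow> nat) \<Rightarrow> nat \<Rightarrow> nat multiset" where
  "expand c y = (if \<exists>x. c x \<noteq> 0 \<and> x < y \<and> y = c x * x
     then repeat_mset (c (previous c y)) (expand c (previous c y)) else {#y#})"
  by auto
termination
proof (relation "measure snd")
  fix c :: "nat \<Rightarrow> nat" and y
  assume "\<exists>x. c x \<noteq> 0 \<and> x < y \<and> y = c x * x"
  then have "previous c y < y"
    unfolding previous_def by (rule someI2_ex) auto
  then show "((c, previous c y), (c, y)) \<in> measure snd" by simp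
qed simp

declare expand.simps [simp del]

lemma expand_mult:
  assumes "inj_on (\<lambda>y. c y * y) {y. c y \<noteq> 0}" "2 \<le> c x" "0 < x"
  shows "expand c (c x * x) = repeat_mset (c x) (expand c x)"
proof -
  have x: "c x \<noteq> 0 \<and> x < c x * x \<and> c x * x = c x * x" using assms(2,3) by simp
  have "previous c (c x * x) = x"
    unfolding previous_def
  proof (rule some_equality)
    show "c x \<noteq> 0 \<and> x < c x * x \<and> c x * x = c x * x" by (rule x)
    show "z = x" if "c z \<noteq> 0 \<and> z < c x * x \<and> c x * x = c z * z" for z
      using that x assms(1) by (metis (mono_tags, lifting) inj_onD mem_Collect_eq)
  qed
  moreover have "\<exists>z. c z \<noteq> 0 \<and> z < c x * x \<and> c x * x = c z * z" using x by blast
  ultimately show ?thesis by (subst expand.simps) simp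
qed

lemma sum_mset_replicate_mset_eq_repeat:
  "sum_mset (replicate_mset k X) = repeat_mset k X"
  by (induction k) auto

text \<open>As long as some \<open>y\<close> occurs \<open>c y\<close> times, carry. This replaces
  at least two parts by one, so the size drops, while the sum and, by \<open>expand_mult\<close>,
  the expansion stay the same.\<close>

lemma ex_bounded_mults:
  fixes c :: "nat \<Rightarrow> nat"
  assumes "inj_on (\<lambda>y. c y * y) {y. c y \<noteq> 0}"
    and "\<And>y. c y \<noteq> 0 \<Longrightarrow> 2 \<le> c y \<and> 0 < y \<and> c (c y * y) \<noteq> 0"
    and "\<forall>y\<in>#Y. c y \<noteq> 0"
  shows "\<exists>Y'. (\<forall>y\<in>#Y'. count Y' y < c y) \<and> sum_mset Y' = sum_mset Y \<and>
    (\<Sum>y\<in>#Y'. expand c y) = (\<Sum>y\<in>#Y. expand c y)"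
  using assms(3)
proof (induction "size Y" arbitrary: Y rule: less_induct)
  case less
  show ?case
  proof (cases "\<forall>y\<in>#Y. count Y y < c y")
    case False
    then obtain y where y: "y \<in># Y" "c y \<le> count Y y" by (auto simp: not_less)
    define Y0 where "Y0 = Y - replicate_mset (c y) y"
    have Y: "Y = Y0 + replicate_mset (c y) y"
      using y(2) by (simp add: Y0_def count_le_replicate_mset_subset_eq)
    have cy: "2 \<le> c y" "0 < y" "c (c y * y) \<noteq> 0" using assms(2) less.prems y(1) by auto
    have "size (add_mset (c y * y) Y0) < size Y" using cy(1) by (simp add: Y)
    moreover have "\<forall>x\<in>#add_mset (c y * y) Y0. c x \<noteq> 0" using less.prems cy(3) Y by auto
    ultimately obtain Y' where Y': "\<forall>y\<in>#Y'. count Y' y < c y"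
      "sum_mset Y' = sum_mset (add_mset (c y * y) Y0)"
      "(\<Sum>y\<in>#Y'. expand c y) = (\<Sum>y\<in>#add_mset (c y * y) Y0. expand c y)"
      using less.hyps by blast
    moreover have "sum_mset (add_mset (c y * y) Y0) = sum_mset Y"
      by (simp add: Y sum_mset_replicate_mset)
    moreover have "(\<Sum>y\<in>#add_mset (c y * y) Y0. expand c y) = (\<Sum>y\<in>#Y. expand c y)"
      using expand_mult[OF assms(1) cy(1,2)] by (simp add: Y sum_mset_replicate_mset_eq_repeat)
    ultimately show ?thesis by auto
  qed blast
qed

text \<open>This is Glaisher's argument: carrying, that is, replacing \<open>c y\<close> copies of \<open>y\<close> by
  \<open>c y * y\<close>, is undone by \<^const>\<open>expand\<close>.\<close>

lemma card_primitive_le_card_bounded_mults: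
  fixes c :: "nat \<Rightarrow> nat"
  assumes "inj_on (\<lambda>y. c y * y) {y. c y \<noteq> 0}"
    and "\<And>y. c y \<noteq> 0 \<Longrightarrow> 2 \<le> c y \<and> 0 < y \<and> c (c y * y) \<noteq> 0"
  shows "card {X \<in> partitions_of n. \<forall>y\<in>#X. c y \<noteq> 0 \<and> (\<forall>x. c x \<noteq> 0 \<longrightarrow> y \<noteq> c x * x)} \<le>
    card {Y \<in> partitions_of n. \<forall>y\<in>#Y. count Y y < c y}" (is "card ?A \<le> card ?B")
proof -
  have "?A \<subseteq> (\<lambda>Y. \<Sum>y\<in>#Y. expand c y) ` ?B"
  proof
    fix X assume X: "X \<in> ?A"
    \<comment> \<open>A part that arises from no other is its own expansion.\<close>
    have "(\<Sum>y\<in>#X. expand c y) = (\<Sum>y\<in>#X. {#y#})"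
      using X by (intro arg_cong[of _ _ sum_mset] image_mset_cong) (subst expand.simps, auto)
    then have eX: "(\<Sum>y\<in>#X. expand c y) = X" by simp
    obtain Y where Y: "\<forall>y\<in>#Y. count Y y < c y" "sum_mset Y = sum_mset X"
      "(\<Sum>y\<in>#Y. expand c y) = (\<Sum>y\<in>#X. expand c y)"
      using ex_bounded_mults[of c X, OF assms] X by auto
    have "0 < y" if "y \<in># Y" for y using assms(2)[of y] Y(1) that by fastforce
    then have "Y \<in> ?B" using X Y by (auto simp: partitions_of_def)
    then show "X \<in> (\<lambda>Y. \<Sum>y\<in>#Y. expand c y) ` ?B" using Y(3) eX by force
  qed
  then show ?thesis
    by (intro surj_card_le) (simp_all add: finite_partitions_of)
qed

section \<open>Comparison of partitions with different sets of parts\<close>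

lemma image_mset_inj_on:
  assumes "inj_on f A" "set_mset X \<subseteq> A" "set_mset Y \<subseteq> A" "image_mset f X = image_mset f Y"
  shows "X = Y"
proof -
  have "image_mset (inv_into A f) (image_mset f Z) = Z" if "set_mset Z \<subseteq> A" for Z
  proof -
    have "image_mset (inv_into A f) (image_mset f Z) = image_mset id Z"
      unfolding multiset.map_comp using that
      by (intro image_mset_cong) (auto simp: inv_into_f_f[OF assms(1)])
    then show ?thesis by simp
  qed
  then show ?thesis using assms by metis
qed

text \<open>Andrews' comparison of partition functions: the part \<open>u\<close> is the only one that is turned
  entirely into ones, so its multiplicity can be recovered from the size of the partition.\<close>

lemma card_parts_mono:
  fixes f :: "nat \<Rightarrow> nat"
  assumes "inj_on f (S - {u})" "\<And>x. x \<in> S - {u} \<Longrightarrow> f x \<in> T - {1} \<and> f x \<le> x"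
    "1 \<in> T" "0 < u" "0 \<notin> T"
  shows "card {X \<in> partitions_of n. set_mset X \<subseteq> S} \<le> card {X \<in> partitions_of n. set_mset X \<subseteq> T}"
    (is "card ?A \<le> card ?B")
proof -
  define h where "h X = image_mset f {#x \<in># X. x \<noteq> u#}" for X
  define g where "g X = h X + replicate_mset (n - sum_mset (h X)) 1" for X
  have hT: "y \<in> T - {1}" if "X \<in> ?A" "y \<in># h X" for X y
    using that assms(2) by (force simp: h_def)
  have hn: "sum_mset (h X) \<le> n" if "X \<in> ?A" for X
  proof -
    have *: "sum_mset (image_mset f Z) \<le> sum_mset Z" if "set_mset Z \<subseteq> S - {u}" for Z
      using that assms(2) by (induction Z) (auto intro: add_mono)
    then have "sum_mset (h X) \<le> sum_mset {#x \<in># X. x \<noteq> u#}"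
      unfolding h_def using that by (intro *) auto
    also have "\<dots> \<le> sum_mset X" by (metis le_add1 multiset_partition sum_mset.union)
    finally show ?thesis using that by (simp add: partitions_of_def)
  qed
  have "inj_on g ?A"
  proof (rule inj_onI)
    fix X Y assume XY: "X \<in> ?A" "Y \<in> ?A" "g X = g Y"
    \<comment> \<open>Since \<open>f\<close> never takes the value 1, the ones in \<open>g X\<close>
      are exactly the filling.\<close>
    have r: "{#x \<in># g X. x \<noteq> 1#} = h X" if "X \<in> ?A" for X
    proof -
      have "{#x \<in># h X. x \<noteq> 1#} = h X" using hT[OF that] by (auto simp: filter_mset_eq_conv)
      then show ?thesis by (simp add: g_def)
    qed
    have "h X = h Y" using r XY by metis
    then have eq: "{#x \<in># X. x \<noteq> u#} = {#x \<in># Y. x \<noteq> u#}"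
      unfolding h_def by (rule image_mset_inj_on[OF assms(1), rotated 2]) (use XY in auto)
    have e: "X = {#x \<in># X. x \<noteq> u#} + replicate_mset (count X u) u" for X
      by (rule multiset_eqI) auto
    have "sum_mset X = sum_mset Y" using XY by (simp add: partitions_of_def)
    then have "count X u * u = count Y u * u"
      using eq by (subst (asm) e[of X], subst (asm) e[of Y]) (simp add: sum_mset_replicate_mset)
    then show "X = Y" using e[of X] e[of Y] eq assms(4) by simp
  qed
  moreover have "g ` ?A \<subseteq> ?B"
  proof
    fix Y assume "Y \<in> g ` ?A"
    then obtain X where X: "X \<in> ?A" "Y = g X" by auto
    have "sum_mset Y = n" using hn[OF X(1)] by (simp add: X(2) g_def sum_mset_replicate_mset)
    moreover have "set_mset Y \<subseteq> T" using hT[OF X(1)] assms(3)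
      by (auto simp: X(2) g_def split: if_splits)
    ultimately show "Y \<in> ?B" using assms(5) by (auto simp: partitions_of_def intro: gr0I)
  qed
  ultimately show ?thesis
    by (intro card_inj_on_le) (simp_all add: finite_partitions_of)
qed

section \<open>From the parts counted by \<open>Q_mm\<close> to stored partitions\<close>

definition primitive :: "nat \<Rightarrow> nat list \<Rightarrow> nat \<Rightarrow> bool" where
  "primitive M cs y \<longleftrightarrow> rad M 1 cs y \<noteq> 0 \<and> (\<forall>x. rad M 1 cs x \<noteq> 0 \<longrightarrow> y \<noteq> rad M 1 cs x * x)"

lemma rad_mod: "rad M b cs (y mod M) = rad M b cs y"
  by (induction cs arbitrary: b) auto

lemma rad_in_set: "rad M b cs y \<noteq> 0 \<Longrightarrow> rad M b cs y \<in> set cs"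
  by (induction cs arbitrary: b) (auto split: if_splits)

lemma rad_0: "0 < b \<Longrightarrow> 0 \<notin> set cs \<Longrightarrow> rad M b cs 0 = 0"
  by (induction cs arbitrary: b) auto

text \<open>The parts allowed in \<open>Q_mm\<close>, divided by \<open>a\<close>, where
  \<open>d + 3 = a * m\<close>. The condition \<open>m \<le> x\<close> removes 1 and
  \<open>m - 1\<close>, the quotients of the forbidden parts.\<close>

definition sparse_parts :: "nat \<Rightarrow> nat set" where
  "sparse_parts m = {x. m \<le> x \<and> (x mod m = 1 \<or> x mod m = m - 1)}"

text \<open>Chains the comparison, Glaisher's argument and the colour by colour injection. The
  factor of a part depends only on its residue, so injectivity and closure of carrying need only be
  known for residues. The sequence \<open>\<tau>\<close> supplies distinct primitive parts that lie
  below \<open>2 * m - 1\<close>, \<open>2 * m + 1\<close>, \<open>3 * m - 1\<close>,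
  \<open>3 * m + 1\<close> and so on, or equal them.\<close>

lemma card_sparse_le_card_gapless:
  assumes "prod_list cs = Suc M" "\<forall>c\<in>set cs. 2 \<le> c" "2 \<le> M" "3 \<le> m"
    and inj: "\<And>r s. r < M \<Longrightarrow> s < M \<Longrightarrow> rad M 1 cs r \<noteq> 0 \<Longrightarrow> rad M 1 cs s \<noteq> 0 \<Longrightarrow>
      rad M 1 cs r * r mod M = rad M 1 cs s * s mod M \<Longrightarrow> r = s"
    and closed: "\<And>r. r < M \<Longrightarrow> rad M 1 cs r \<noteq> 0 \<Longrightarrow> rad M 1 cs (rad M 1 cs r * r mod M) \<noteq> 0"
    and \<tau>: "inj \<tau>" "\<And>i. primitive M cs (\<tau> i) \<and> \<tau> i \<noteq> 1"
      "\<And>i. \<tau> (2 * i) \<le> m * (i + 2) - 1" "\<And>i. \<tau> (2 * i + 1) \<le> m * (i + 2) + 1"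
  shows "card {X \<in> partitions_of n. set_mset X \<subseteq> sparse_parts m} \<le> card (gapless M (Suc M) n)"
proof -
  define c where "c = rad M 1 cs"
  have mod: "c y * y mod M = c (y mod M) * (y mod M) mod M" for y
    by (simp add: c_def rad_mod mod_simps)
  have c2: "2 \<le> c y \<and> 0 < y \<and> c (c y * y) \<noteq> 0" if "c y \<noteq> 0" for y
  proof (intro conjI)
    show "2 \<le> c y" using rad_in_set[of M 1 cs y] that assms(2) by (auto simp: c_def)
    have "0 \<notin> set cs" using assms(2) by force
    then show "0 < y" using rad_0[of 1 cs M] that by (cases y) (auto simp: c_def)
    have "c (c (y mod M) * (y mod M) mod M) \<noteq> 0"
      using closed[of "y mod M"] assms(3) that by (simp add: c_def rad_mod)
    then show "c (c y * y) \<noteq> 0" by (metis mod c_def rad_mod)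
  qed
  have cinj: "inj_on (\<lambda>y. c y * y) {y. c y \<noteq> 0}"
  proof (rule inj_onI, clarify)
    fix x y assume xy: "0 < c x" "0 < c y" "c x * x = c y * y"
    have "x mod M = y mod M"
      using inj[of "x mod M" "y mod M"] mod[of x] mod[of y] xy assms(3)
      by (simp add: c_def rad_mod)
    then have "c x = c y" by (metis c_def rad_mod)
    then show "x = y" using xy by simp
  qed
  define T where "T = {y. primitive M cs y}"
  have cs: "cs \<noteq> []" using assms(1,3) by auto
  have coloured: "finite (coloured M 1 cs n)"
    "card (coloured M 1 cs n) \<le> card (gapless M (Suc M) n)"
    using card_coloured_le[of 1 cs M n] assms(1-3) by simp_all
  \<comment> \<open>Position in the list \<open>2 * m - 1\<close>, \<open>2 * m + 1\<close>,
    \<open>3 * m - 1\<close>, and so on. The offsets differ because \<open>m * (i + 2) - 1\<close>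
    has quotient \<open>i + 1\<close>.\<close>
  define idx where "idx x = (if x mod m = 1 then 2 * (x div m - 2) + 1 else 2 * (x div m - 1))" for x
  have idx: "x = m * (i + 2) + 1 \<and> idx x = 2 * i + 1 \<or> x = m * (i + 2) - 1 \<and> idx x = 2 * i"
    if "x \<in> sparse_parts m - {m + 1}" "i = (if x mod m = 1 then x div m - 2 else x div m - 1)" for x i
  proof (cases "x mod m = 1")
    case True
    have x: "x = m * (x div m) + 1" using True by (metis mult_div_mod_eq)
    have "x div m \<noteq> 0" using that(1) assms(4) by (auto simp: sparse_parts_def div_eq_0_iff)
    moreover have "x div m \<noteq> 1"
    proof
      assume "x div m = 1"
      then show False using x that(1) by auto
    qed
    ultimately have "x div m = i + 2" using that(2) True by simp
    then show ?thesis using x True by (auto simp: idx_def)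
  next
    case False
    then have r: "x mod m = m - 1" using that(1) by (auto simp: sparse_parts_def)
    have x: "x = m * (x div m) + (m - 1)" using r by (metis mult_div_mod_eq)
    have "x div m \<noteq> 0" using that(1) assms(4) by (auto simp: sparse_parts_def div_eq_0_iff)
    then have d: "x div m = i + 1" using that(2) False by simp
    then have "x = m * (i + 2) - 1" using x assms(4) by simp
    then show ?thesis using False d by (auto simp: idx_def)
  qed
  have "card {X \<in> partitions_of n. set_mset X \<subseteq> sparse_parts m} \<le>
      card {X \<in> partitions_of n. set_mset X \<subseteq> T}"
  \<comment> \<open>The smallest sparse part above \<open>m\<close>, namely \<open>m + 1\<close>,
    has no partner in \<open>\<tau>\<close> and is the one traded for ones.\<close>
  proof (rule card_parts_mono[where u = "m + 1" and f = "\<lambda>x. \<tau> (idx x)"])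
    show "inj_on (\<lambda>x. \<tau> (idx x)) (sparse_parts m - {m + 1})"
    proof (rule inj_onI)
      fix x y assume xy: "x \<in> sparse_parts m - {m + 1}" "y \<in> sparse_parts m - {m + 1}"
        "\<tau> (idx x) = \<tau> (idx y)"
      then have e: "idx x = idx y" using \<tau>(1) by (auto dest: injD)
      have "2 * i + 1 \<noteq> 2 * j" "2 * j \<noteq> 2 * i + 1" for i j :: nat by presburger+
      then show "x = y"
        using idx[OF xy(1) refl] idx[OF xy(2) refl] e by (smt (verit) Suc_1 add_right_cancel mult_left_cancel nat.distinct(1))
    qed
    show "\<tau> (idx x) \<in> T - {1} \<and> \<tau> (idx x) \<le> x"
      if x: "x \<in> sparse_parts m - {m + 1}" for x
    proof -
      obtain i where "x = m * (i + 2) + 1 \<and> idx x = 2 * i + 1 \<or> x = m * (i + 2) - 1 \<and> idx x = 2 * i"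
        using idx[OF x refl] by blast
      then have "\<tau> (idx x) \<le> x" using \<tau>(3,4) by metis
      then show ?thesis using \<tau>(2)[of "idx x"] by (simp add: T_def)
    qed
    have "1 \<noteq> c x * x" if "c x \<noteq> 0" for x using c2[OF that] by auto
    moreover have "rad M 1 cs 1 \<noteq> 0" using cs assms(2,3) by (cases cs) auto
    ultimately show "1 \<in> T" by (auto simp: T_def primitive_def c_def)
    show "0 \<notin> T" using c2 by (auto simp: T_def primitive_def c_def)
  qed simp
  also have "{X \<in> partitions_of n. set_mset X \<subseteq> T} =
      {X \<in> partitions_of n. \<forall>y\<in>#X. c y \<noteq> 0 \<and> (\<forall>x. c x \<noteq> 0 \<longrightarrow> y \<noteq> c x * x)}"
    by (auto simp: T_def primitive_def c_def)
  also have "card \<dots> \<le> card {Y \<in> partitions_of n. \<forall>y\<in>#Y. count Y y < c y}"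
    by (rule card_primitive_le_card_bounded_mults[OF cinj c2])
  \<comment> \<open>Before the first colour nothing has been stored, hence the empty first
    component.\<close>
  also have "\<dots> \<le> card (coloured M 1 cs n)"
    using coloured(1)
    by (intro card_inj_on_le[where f = "\<lambda>Y. ({#}, Y)"])
      (auto simp: inj_on_def coloured_def partitions_of_def weight_def c_def)
  also have "\<dots> \<le> card (gapless M (Suc M) n)"
    by (rule coloured(2))
  finally show ?thesis .
qed

section \<open>The gaps 35, 47 and \<open>32 * w - 1\<close>\<close>

text \<open>If \<open>y\<close> arises from \<open>x\<close>, then the factor belonging to the
  residue of \<open>x\<close> divides \<open>y\<close>; hence it suffices to inspect
  residues.\<close>

lemma primitiveI:
  assumes "0 < M" "rad M 1 cs y \<noteq> 0"
    "\<And>r. r < M \<Longrightarrow> rad M 1 cs r \<noteq> 0 \<Longrightarrow> rad M 1 cs r * r mod M = y mod M \<Longrightarrow> \<not> rad M 1 cs r dvd y"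
  shows "primitive M cs y"
  unfolding primitive_def
proof (intro conjI allI impI notI)
  fix x assume x: "rad M 1 cs x \<noteq> 0" "y = rad M 1 cs x * x"
  have "rad M 1 cs (x mod M) * (x mod M) mod M = y mod M"
    by (simp add: x(2) rad_mod mod_simps)
  then have "\<not> rad M 1 cs (x mod M) dvd y"
    using x(1) assms(1) assms(3)[of "x mod M"] by (simp add: rad_mod)
  then show False using x(2) by (simp add: rad_mod)
qed (use assms in auto)

text \<open>For \<open>M = 35\<close> and \<open>M = 47\<close>, the lists \<open>ts\<close> below contain the primitive parts in one period,
  starting after the part 1.\<close>

definition periodic :: "nat \<Rightarrow> nat list \<Rightarrow> nat \<Rightarrow> nat" where
  "periodic p ts i = p * (i div length ts) + ts ! (i mod length ts)"

text \<open>The entries lie in a window of length \<open>p\<close> starting at 2, so subtracting 2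
  and dividing by \<open>p\<close> recovers the period; distinctness then gives the
  position.\<close>

lemma inj_periodic:
  assumes "distinct ts" "\<forall>t\<in>set ts. 2 \<le> t \<and> t < p + 2" "ts \<noteq> []"
  shows "inj (periodic p ts)"
proof (rule injI)
  fix i j assume eq: "periodic p ts i = periodic p ts j"
  have *: "ts ! (k mod length ts) \<in> set ts" for k using assms(3) by simp
  have p: "0 < p" using assms(2) *[of 0] by force
  have d: "(periodic p ts k - 2) div p = k div length ts \<and>
      periodic p ts k = p * (k div length ts) + ts ! (k mod length ts)" for k
  proof -
    obtain s where s: "ts ! (k mod length ts) = s + 2" "s < p"
      using assms(2) *[of k] by (metis add.commute add_less_cancel_right le_Suc_ex)
    then show ?thesis by (simp add: periodic_def)
  qed
  have "i div length ts = j div length ts" using d[of i] d[of j] eq by metis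
  moreover from this have "ts ! (i mod length ts) = ts ! (j mod length ts)" 
    using eq by (simp add: periodic_def)
  then have "i mod length ts = j mod length ts"
    using assms(1,3) by (simp add: nth_eq_iff_index_eq)
  ultimately show "i = j" by (metis mult_div_mod_eq)
qed

text \<open>One period has \<open>h\<close> pairs: it raises the values by \<open>p\<close> and the
  bounds by \<open>m * h\<close>, so checking the first period is enough.\<close>

lemma periodic_le:
  assumes "length ts = 2 * h" "0 < h" "p \<le> m * h"
    "\<forall>q<h. ts ! (2 * q) + 1 \<le> m * (q + 2) \<and> ts ! (2 * q + 1) \<le> m * (q + 2) + 1"
  shows "periodic p ts (2 * i) \<le> m * (i + 2) - 1" "periodic p ts (2 * i + 1) \<le> m * (i + 2) + 1"
proof -
  define l q where "l = i div h" and "q = i mod h"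
  have i: "i = h * l + q" "q < h" using assms(2) by (simp_all add: l_def q_def)
  have 1: "2 * i = (2 * h) * l + 2 * q" "2 * i + 1 = (2 * h) * l + (2 * q + 1)" using i by simp_all
  have e: "2 * i div (2 * h) = l" "2 * i mod (2 * h) = 2 * q"
    using i(2) unfolding 1(1) by simp_all
  have o: "(2 * i + 1) div (2 * h) = l" "(2 * i + 1) mod (2 * h) = 2 * q + 1"
    using i(2) unfolding 1(2) by (subst div_mult_self4 mod_mult_self4; simp)+
  have pl: "p * l \<le> m * (h * l)" using mult_le_mono1[OF assms(3), of l] by (simp add: mult.assoc)
  have a: "ts ! (2 * q) + 1 \<le> m * (q + 2)" "ts ! (2 * q + 1) \<le> m * (q + 2) + 1"
    using assms(4) i(2) by auto
  have m: "m * (i + 2) = m * (h * l) + m * (q + 2)" by (simp add: i(1) algebra_simps)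
  show "periodic p ts (2 * i) \<le> m * (i + 2) - 1"
    unfolding periodic_def assms(1) e m using pl a(1) by linarith
  show "periodic p ts (2 * i + 1) \<le> m * (i + 2) + 1"
    unfolding periodic_def assms(1) o m using pl a(2) by linarith
qed

text \<open>Carrying leads through the residues 1, 2, 4, 12 and back to 1, with factors 2, 2, 3, 3.
  So residues 2 and 4 require odd parts, residues 12 and 1 parts not divisible by 3. These are 14
  parts per period 210, and \<open>210 \<le> 7 * 31\<close>.\<close>

lemma sparse_35:
  assumes "31 \<le> m"
  shows "card {X \<in> partitions_of n. set_mset X \<subseteq> sparse_parts m} \<le> card (gapless 35 36 n)"
proof -
  define cs :: "nat list" where "cs = [2, 2, 3, 3]"
  define ts :: "nat list" where "ts = [37, 39, 47, 71, 82, 106, 107, 109, 152, 176, 177, 179, 187, 211]"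
  have rad: "rad 35 (Suc 0) cs y = (if y mod 35 = 1 then 2 else if y mod 35 = 2 then 2
      else if y mod 35 = 4 then 3 else if y mod 35 = 12 then 3 else 0)" for y
    by (simp add: cs_def)
  have "card {X \<in> partitions_of n. set_mset X \<subseteq> sparse_parts m} \<le> card (gapless 35 (Suc 35) n)"
  proof (rule card_sparse_le_card_gapless[where \<tau> = "periodic 210 ts" and cs = cs])
    show "inj (periodic 210 ts)"
      by (rule inj_periodic) (simp_all add: ts_def)
    show "primitive 35 cs (periodic 210 ts i) \<and> periodic 210 ts i \<noteq> 1" for i
    proof -
      obtain l t where y: "periodic 210 ts i = 210 * l + t" "t \<in> set ts"
        unfolding periodic_def by (metis length_greater_0_conv list.discI mod_less_divisor nth_mem ts_def)
      define y where "y = 210 * l + t"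
      \<comment> \<open>As 210 is a multiple of 35, 2 and 3, all that decides primitivity depends on
        \<open>t\<close> alone.\<close>
      have "y = 35 * (6 * l) + t" "y = 2 * (105 * l) + t" "y = 3 * (70 * l) + t"
        by (simp_all add: y_def)
      then have m: "y mod 35 = t mod 35" "y mod 2 = t mod 2" "y mod 3 = t mod 3"
        by (metis mod_mult_self4)+
      have "\<forall>t\<in>set ts. (t mod 35 \<in> {2, 4} \<and> t mod 2 \<noteq> 0) \<or> (t mod 35 \<in> {1, 12} \<and> t mod 3 \<noteq> 0)"
        by (simp add: ts_def)
      then have "(y mod 35 \<in> {2, 4} \<and> \<not> 2 dvd y) \<or> (y mod 35 \<in> {1, 12} \<and> \<not> 3 dvd y)"
        unfolding dvd_eq_mod_eq_0 m using y(2) by (rule bspec)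
      then have "primitive 35 cs y"
        by (intro primitiveI) (auto simp: rad split: if_splits)
      then show ?thesis using y by (auto simp: y_def ts_def)
    qed
    have le: "31 * (i + 2) \<le> m * (i + 2)" for i using assms by (rule mult_le_mono1)
    have q: "\<forall>q<7. ts ! (2 * q) + 1 \<le> 31 * (q + 2) \<and> ts ! (2 * q + 1) \<le> 31 * (q + 2) + 1"
      by (simp add: ts_def numeral_eq_Suc less_Suc_eq)
    note p = periodic_le[of ts 7 210 31, OF _ _ _ q]
    show "periodic 210 ts (2 * i) \<le> m * (i + 2) - 1" for i
      using p(1)[of i] le[of i] by (simp add: ts_def)
    show "periodic 210 ts (2 * i + 1) \<le> m * (i + 2) + 1" for i
      using p(2)[of i] le[of i] by (simp add: ts_def)
    show "prod_list cs = Suc 35" "\<forall>c\<in>set cs. 2 \<le> c" by (simp_all add: cs_def)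
    show "2 \<le> (35::nat)" "3 \<le> m" using assms by simp_all
    have res: "r \<in> {1, 2, 4, 12}" if "r < 35" "rad 35 1 cs r \<noteq> 0" for r
      using that by (simp add: rad split: if_splits)
    fix r s assume r: "r < 35" "rad 35 1 cs r \<noteq> 0"
    show "rad 35 1 cs (rad 35 1 cs r * r mod 35) \<noteq> 0"
      using res[OF r] by (elim insertE emptyE) (simp_all add: rad)
    assume s: "s < 35" "rad 35 1 cs s \<noteq> 0" "rad 35 1 cs r * r mod 35 = rad 35 1 cs s * s mod 35"
    show "r = s"
      using res[OF r] res[OF s(1,2)] s(3) by (elim insertE emptyE) (simp_all add: rad)
  qed
  then show ?thesis by simp
qed

text \<open>The residues 1, 2, 4, 8, 16 with factors 2, 2, 2, 2, 3 form the cycle. Odd parts remain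
  for 2, 4, 8, 16, and parts not divisible by 3 for 1: 16 per period 282, and
  \<open>282 \<le> 8 * 36\<close>.\<close>

lemma sparse_47:
  assumes "36 \<le> m"
  shows "card {X \<in> partitions_of n. set_mset X \<subseteq> sparse_parts m} \<le> card (gapless 47 48 n)"
proof -
  define cs :: "nat list" where "cs = [2, 2, 2, 2, 3]"
  define ts :: "nat list" where
    "ts = [49, 51, 55, 63, 95, 142, 143, 145, 149, 157, 236, 237, 239, 243, 251, 283]"
  have rad: "rad 47 (Suc 0) cs y = (if y mod 47 = 1 then 2 else if y mod 47 = 2 then 2
      else if y mod 47 = 4 then 2 else if y mod 47 = 8 then 2 else if y mod 47 = 16 then 3 else 0)" for y
    by (simp add: cs_def)
  have "card {X \<in> partitions_of n. set_mset X \<subseteq> sparse_parts m} \<le> card (gapless 47 (Suc 47) n)"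
  proof (rule card_sparse_le_card_gapless[where \<tau> = "periodic 282 ts" and cs = cs])
    show "inj (periodic 282 ts)"
      by (rule inj_periodic) (simp_all add: ts_def)
    show "primitive 47 cs (periodic 282 ts i) \<and> periodic 282 ts i \<noteq> 1" for i
    proof -
      obtain l t where y: "periodic 282 ts i = 282 * l + t" "t \<in> set ts"
        unfolding periodic_def by (metis length_greater_0_conv list.discI mod_less_divisor nth_mem ts_def)
      define y where "y = 282 * l + t"
      have "y = 47 * (6 * l) + t" "y = 2 * (141 * l) + t" "y = 3 * (94 * l) + t"
        by (simp_all add: y_def)
      then have m: "y mod 47 = t mod 47" "y mod 2 = t mod 2" "y mod 3 = t mod 3"
        by (metis mod_mult_self4)+
      have "\<forall>t\<in>set ts. (t mod 47 \<in> {2, 4, 8, 16} \<and> t mod 2 \<noteq> 0) \<or> (t mod 47 = 1 \<and> t mod 3 \<noteq> 0)"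
        by (simp add: ts_def)
      then have "(y mod 47 \<in> {2, 4, 8, 16} \<and> \<not> 2 dvd y) \<or> (y mod 47 = 1 \<and> \<not> 3 dvd y)"
        unfolding dvd_eq_mod_eq_0 m using y(2) by (rule bspec)
      then have "primitive 47 cs y"
        by (intro primitiveI) (auto simp: rad split: if_splits)
      then show ?thesis using y by (auto simp: y_def ts_def)
    qed
    have le: "36 * (i + 2) \<le> m * (i + 2)" for i using assms by (rule mult_le_mono1)
    have q: "\<forall>q<8. ts ! (2 * q) + 1 \<le> 36 * (q + 2) \<and> ts ! (2 * q + 1) \<le> 36 * (q + 2) + 1"
      by (simp add: ts_def numeral_eq_Suc less_Suc_eq)
    note p = periodic_le[of ts 8 282 36, OF _ _ _ q]
    show "periodic 282 ts (2 * i) \<le> m * (i + 2) - 1" for i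
      using p(1)[of i] le[of i] by (simp add: ts_def)
    show "periodic 282 ts (2 * i + 1) \<le> m * (i + 2) + 1" for i
      using p(2)[of i] le[of i] by (simp add: ts_def)
    show "prod_list cs = Suc 47" "\<forall>c\<in>set cs. 2 \<le> c" by (simp_all add: cs_def)
    show "2 \<le> (47::nat)" "3 \<le> m" using assms by simp_all
    have res: "r \<in> {1, 2, 4, 8, 16}" if "r < 47" "rad 47 1 cs r \<noteq> 0" for r
      using that by (simp add: rad split: if_splits)
    fix r s assume r: "r < 47" "rad 47 1 cs r \<noteq> 0"
    show "rad 47 1 cs (rad 47 1 cs r * r mod 47) \<noteq> 0"
      using res[OF r] by (elim insertE emptyE) (simp_all add: rad)
    assume s: "s < 47" "rad 47 1 cs s \<noteq> 0" "rad 47 1 cs r * r mod 47 = rad 47 1 cs s * s mod 47"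
    show "r = s"
      using res[OF r] res[OF s(1,2)] s(3) by (elim insertE emptyE) (simp_all add: rad)
  qed
  then show ?thesis by simp
qed

text \<open>Now the cycle is 1, 2, 4, 8, 16, 32 with last factor \<open>w\<close>. Six primitive
  parts are selected in every stretch of length \<open>2 * M\<close>, to be compared with three
  pairs of bounds, which rise by \<open>3 * m\<close>.\<close>

lemma sparse_32w:
  assumes "2 \<le> w" "M = 32 * w - 1" "2 * M \<le> 3 * m"
  shows "card {X \<in> partitions_of n. set_mset X \<subseteq> sparse_parts m} \<le> card (gapless M (Suc M) n)"
proof -
  define cs where "cs = [2, 2, 2, 2, 2, w]"
  have M: "63 \<le> M" "32 * w = M + 1" using assms(1,2) by linarith+
  have "(M + 1) mod M = 1" using M(1) unfolding mod_add_self1 by simp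
  then have Mw: "32 * w mod M = 1" "w * 32 mod M = 1" by (simp_all only: mult.commute[of w] M(2))
  have Modd: "odd M"
  proof -
    have "even (M + 1)" unfolding M(2)[symmetric] by simp
    then show ?thesis by simp
  qed
  have rad: "rad M (Suc 0) cs y = (if y mod M = 1 then 2 else if y mod M = 2 then 2
      else if y mod M = 4 then 2 else if y mod M = 8 then 2 else if y mod M = 16 then 2
      else if y mod M = 32 then w else 0)" for y
    by (simp add: cs_def)
  have red: "k mod M = k" if "k \<le> 32" for k using that M(1) by simp
  \<comment> \<open>Odd multiples of the odd \<open>M\<close> make the first five parts odd. For
    residue 1, \<open>w\<close> cannot divide both candidates: it would divide their difference
    \<open>M\<close> as well as \<open>M + 1\<close>.\<close>
  define \<tau> where "\<tau> i = (let l = i div 6; t = i mod 6 in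
      if t < 5 then M * (2 * l + 1) + 2 ^ (t + 1)
      else if w dvd M * (2 * l + 1) + 1 then M * (2 * l + 2) + 1 else M * (2 * l + 1) + 1)" for i
  have pow: "(2::nat) ^ (t + 1) \<in> {2, 4, 8, 16, 32}" if "t < 5" for t
  proof -
    have "t = 0 \<or> t = 1 \<or> t = 2 \<or> t = 3 \<or> t = 4" using that by linarith
    then show ?thesis by auto
  qed
  show ?thesis
  proof (rule card_sparse_le_card_gapless[where \<tau> = \<tau> and cs = cs])
    show "inj \<tau>"
    proof (rule injI)
      fix i j assume eq: "\<tau> i = \<tau> j"
      \<comment> \<open>The six parts of a block fall into a window shorter than
        \<open>2 * M\<close>, so the block number can be read off.\<close>
      have b: "\<exists>s. \<tau> k = 2 * M * (k div 6) + (M + 1 + s) \<and> s \<le> M" for k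
      proof -
        consider "k mod 6 < 5" "\<tau> k = M * (2 * (k div 6) + 1) + 2 ^ (k mod 6 + 1)"
          | "\<tau> k = M * (2 * (k div 6) + 2) + 1" | "\<tau> k = M * (2 * (k div 6) + 1) + 1"
          unfolding \<tau>_def Let_def by meson
        then show ?thesis
        proof cases
          case 1
          then show ?thesis using pow[OF 1(1)] M(1)
            by (intro exI[of _ "2 ^ (k mod 6 + 1) - 1"]) (auto simp: algebra_simps)
        next
          case 2
          then show ?thesis by (intro exI[of _ M]) (simp add: algebra_simps)
        next
          case 3
          then show ?thesis by (intro exI[of _ 0]) (simp add: algebra_simps)
        qed
      qed
      have "(\<tau> k - (M + 1)) div (2 * M) = k div 6" for k
      proof -
        obtain s where "\<tau> k = 2 * M * (k div 6) + (M + 1 + s)" "s \<le> M" using b by blast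
        then show ?thesis using M(1) by simp
      qed
      then have d: "i div 6 = j div 6" using eq by metis
      have "i mod 6 = j mod 6"
      proof -
        have 5: "k mod 6 = 5" if "\<not> k mod 6 < 5" for k :: nat using that by presburger
        have ne: "M + 1 \<noteq> 2 ^ (t + 1)" "2 ^ (t + 1) \<noteq> M + 1" "(1::nat) \<noteq> 2 ^ (t + 1)"
          if "t < 5" for t
          using pow[OF that] M(1) by auto
        show ?thesis using eq d 5[of i] 5[of j] ne[of "i mod 6"] ne[of "j mod 6"]
          by (cases "i mod 6 < 5"; cases "j mod 6 < 5")
            (auto simp: \<tau>_def Let_def algebra_simps split: if_splits)
      qed
      then show "i = j" using d by (metis mult_div_mod_eq)
    qed
    show "primitive M cs (\<tau> i) \<and> \<tau> i \<noteq> 1" for i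
    proof -
      define l where "l = i div 6"
      have ndvd: "\<not> (w dvd M * (2 * l + 1) + 1 \<and> w dvd M * (2 * l + 2) + 1)"
      proof
        assume "w dvd M * (2 * l + 1) + 1 \<and> w dvd M * (2 * l + 2) + 1"
        then have "w dvd (M * (2 * l + 2) + 1) - (M * (2 * l + 1) + 1)" by (intro dvd_diff_nat) auto
        then have "w dvd M" by (simp add: algebra_simps)
        moreover have "w dvd M + 1" unfolding M(2)[symmetric] by simp
        ultimately have "w dvd 1" by (simp only: dvd_add_right_iff)
        then show False using assms(1) by simp
      qed
      have "(\<tau> i mod M \<in> {2, 4, 8, 16, 32} \<and> odd (\<tau> i)) \<or> (\<tau> i mod M = 1 \<and> \<not> w dvd \<tau> i)"
      proof (cases "i mod 6 < 5")
        case True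
        then have t: "\<tau> i = M * (2 * l + 1) + 2 ^ (i mod 6 + 1)" by (simp add: \<tau>_def l_def)
        have "\<tau> i mod M = 2 ^ (i mod 6 + 1)" using pow[OF True] M(1) unfolding t mod_mult_self4 by auto
        moreover have "odd (\<tau> i)" using Modd t by simp
        ultimately show ?thesis using pow[OF True] by metis
      next
        case False
        then have "\<tau> i = (if w dvd M * (2 * l + 1) + 1 then M * (2 * l + 2) + 1 else M * (2 * l + 1) + 1)"
          by (simp add: \<tau>_def l_def)
        then have "\<not> w dvd \<tau> i" "\<exists>k. \<tau> i = M * k + 1" using ndvd by (auto simp del: mult_Suc_right)
        moreover have "(M * k + 1) mod M = 1" for k unfolding mod_mult_self4 using M(1) by simp
        ultimately show ?thesis by metis
      qed
      then have "primitive M cs (\<tau> i)"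
        using M(1) assms(1) Mw by (intro primitiveI) (auto simp: rad red split: if_splits)
      moreover have "\<tau> i \<noteq> 1" using M(1) by (auto simp: \<tau>_def Let_def)
      ultimately show ?thesis by simp
    qed
    have bound: "\<tau> (2 * i) \<le> m * (i + 2) - 1 \<and> \<tau> (2 * i + 1) \<le> m * (i + 2) + 1" for i
    proof -
      define l q where "l = i div 3" and "q = i mod 3"
      have i: "i = 3 * l + q" "q < 3" by (simp_all add: l_def q_def)
      have e: "2 * i div 6 = l" "2 * i mod 6 = 2 * q" "(2 * i + 1) div 6 = l" "(2 * i + 1) mod 6 = 2 * q + 1"
      proof -
        have 1: "2 * i = 6 * l + 2 * q" "2 * i + 1 = 6 * l + (2 * q + 1)" using i by simp_all
        show "2 * i div 6 = l" "2 * i mod 6 = 2 * q" using i(2) unfolding 1(1) by simp_all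
        show "(2 * i + 1) div 6 = l" "(2 * i + 1) mod 6 = 2 * q + 1"
          using i(2) unfolding 1(2) div_mult_self4[OF zero_neq_numeral[symmetric]] mod_mult_self4
          by simp_all
      qed
      have pl: "2 * (M * l) \<le> 3 * (m * l)" using mult_le_mono1[OF assms(3), of l] by (simp add: mult.assoc)
      have mi: "m * (i + 2) = 3 * (m * l) + m * q + 2 * m" by (simp add: i(1) algebra_simps)
      have \<tau>e: "\<tau> (2 * i) = 2 * (M * l) + M + 2 ^ (2 * q + 1)"
      proof -
        have "2 * q < 5" using i(2) by simp
        then show ?thesis unfolding \<tau>_def Let_def e by (simp add: algebra_simps)
      qed
      have \<tau>o: "\<tau> (2 * i + 1) \<le> 2 * (M * l) + (if q < 2 then M + 2 ^ (2 * q + 2) else 2 * M + 1)"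
      proof (cases "q < 2")
        case True
        then have "2 * q + 1 < 5" by simp
        then show ?thesis unfolding \<tau>_def Let_def e using True by (simp add: algebra_simps)
      next
        case False
        then have "\<not> 2 * q + 1 < 5" by simp
        then show ?thesis unfolding \<tau>_def Let_def e using False by (simp add: algebra_simps)
      qed
      consider "q = 0" | "q = 1" | "q = 2" using i(2) by linarith
      then show ?thesis
      proof cases
        case 1
        then have "\<tau> (2 * i) = 2 * (M * l) + M + 2" "\<tau> (2 * i + 1) \<le> 2 * (M * l) + (M + 4)"
          "m * (i + 2) = 3 * (m * l) + 2 * m"
          using \<tau>e \<tau>o mi by simp_all
        then show ?thesis using pl M(1) assms(3) by linarith
      next
        case 2
        then have "\<tau> (2 * i) = 2 * (M * l) + M + 8" "\<tau> (2 * i + 1) \<le> 2 * (M * l) + (M + 16)"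
          "m * (i + 2) = 3 * (m * l) + 3 * m"
          using \<tau>e \<tau>o mi by simp_all
        then show ?thesis using pl M(1) assms(3) by linarith
      next
        case 3
        then have "\<tau> (2 * i) = 2 * (M * l) + M + 32" "\<tau> (2 * i + 1) \<le> 2 * (M * l) + (2 * M + 1)"
          "m * (i + 2) = 3 * (m * l) + 4 * m"
          using \<tau>e \<tau>o mi by simp_all
        then show ?thesis using pl M(1) assms(3) by linarith
      qed
    qed
    show "\<tau> (2 * i) \<le> m * (i + 2) - 1" "\<tau> (2 * i + 1) \<le> m * (i + 2) + 1" for i
      using bound by auto
    show "prod_list cs = Suc M" using M by (simp add: cs_def)
    show "\<forall>c\<in>set cs. 2 \<le> c" using assms(1) by (simp add: cs_def)
    show "2 \<le> M" "3 \<le> m" using M(1) assms(3) by simp_all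
    have res: "r \<in> {1, 2, 4, 8, 16, 32}" if "r < M" "rad M 1 cs r \<noteq> 0" for r
      using that by (simp add: rad split: if_splits)
    have next_res: "rad M 1 cs 1 * 1 mod M = 2" "rad M 1 cs 2 * 2 mod M = 4" "rad M 1 cs 4 * 4 mod M = 8"
      "rad M 1 cs 8 * 8 mod M = 16" "rad M 1 cs 16 * 16 mod M = 32" "rad M 1 cs 32 * 32 mod M = 1"
      using Mw M(1) by (simp_all add: rad red)
    fix r s assume r: "r < M" "rad M 1 cs r \<noteq> 0"
    have "rad M 1 cs r * r mod M \<in> {1, 2, 4, 8, 16, 32}"
      using res[OF r] by (elim insertE emptyE) (simp_all only: next_res, simp_all)
    then show "rad M 1 cs (rad M 1 cs r * r mod M) \<noteq> 0"
      using assms(1) M(1) by (elim insertE emptyE) (simp_all add: rad red)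
    assume s: "s < M" "rad M 1 cs s \<noteq> 0" "rad M 1 cs r * r mod M = rad M 1 cs s * s mod M"
    show "r = s"
      using res[OF r] res[OF s(1,2)] s(3)
      by (elim insertE emptyE) (simp_all only: next_res, simp_all?)
  qed
qed

lemma ex_gap:
  assumes "31 \<le> m"
  shows "\<exists>M\<ge>m. \<forall>n. card {X \<in> partitions_of n. set_mset X \<subseteq> sparse_parts m} \<le>
    card (gapless M (Suc M) n)"
proof -
  consider "m \<le> 35" | "36 \<le> m" "m \<le> 47" | "48 \<le> m" by linarith
  then show ?thesis
  proof cases
    case 1
    then show ?thesis using sparse_35[OF assms] by (intro exI[of _ 35]) simp
  next
    case 2
    then show ?thesis using sparse_47[OF 2(1)] by (intro exI[of _ 47]) simp
  next
    case 3
    \<comment> \<open>The least \<open>w\<close> with \<open>m \<le> 32 * w - 1\<close>.\<close>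
    define w where "w = m div 32 + 1"
    obtain k r where "m = 32 * k + r" "r < 32" "w = k + 1"
      unfolding w_def by (metis mult_div_mod_eq mod_less_divisor zero_less_numeral)
    then have w: "32 * w \<le> m + 32" "m < 32 * w" by linarith+
    then have "2 \<le> w" "m \<le> 32 * w - 1" using 3 by linarith+
    \<comment> \<open>For \<open>w = 2\<close> the left side is 126, and \<open>48 \<le> m\<close>.
      For larger \<open>w\<close>, \<open>64 \<le> m\<close> and
      \<open>32 * w - 1 \<le> m + 31\<close>.\<close>
    moreover have "2 * (32 * w - 1) \<le> 3 * m"
    proof (cases "w = 2")
      case True
      then show ?thesis using 3 by simp
    next
      case False
      then show ?thesis using w \<open>2 \<le> w\<close> by linarith
    qed
    ultimately show ?thesis using sparse_32w[of w "32 * w - 1" m]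
      by (intro exI[of _ "32 * w - 1"]) auto
  qed
qed

section \<open>Restoring the gaps: from stored partitions to \<open>q\<close>\<close>

text \<open>The inverse of the passage to \<^const>\<open>gapless\<close> multisets, scaled by \<open>a\<close>.\<close>

fun spread :: "nat \<Rightarrow> nat \<Rightarrow> nat \<Rightarrow> nat list \<Rightarrow> nat list" where
  "spread a M j [] = []"
| "spread a M j (z # zs) = a * (z + M * j) # spread a M (Suc j) zs"

lemma sum_list_spread:
  "sum_list (spread a M j zs) = a * (sum_list zs + M * (j * length zs + (length zs choose 2)))"
  by (induction zs arbitrary: j) (auto simp: numeral_2_eq_2 algebra_simps)

lemma spread_ge:
  assumes "x \<in> set (spread a M j zs)" "\<forall>z\<in>set zs. y \<le> z"
  shows "a * (y + M * j) \<le> x"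
  using assms
proof (induction zs arbitrary: j)
  case (Cons z zs)
  show ?case
  proof (cases "x = a * (z + M * j)")
    case True
    then show ?thesis using Cons.prems by simp
  next
    case False
    have "a * (y + M * j) \<le> a * (y + M * Suc j)" by (intro mult_le_mono2) simp
    also have "\<dots> \<le> x" by (rule Cons.IH) (use Cons.prems False in auto)
    finally show ?thesis .
  qed
qed simp

lemma sorted_spread: "sorted zs \<Longrightarrow> sorted (spread a M j zs)"
proof (induction zs arbitrary: j)
  case (Cons z zs)
  have "a * (z + M * j) \<le> x" if "x \<in> set (spread a M (Suc j) zs)" for x
    using spread_ge[OF that, of z] Cons.prems by (auto simp: algebra_simps intro: le_trans)
  then show ?case using Cons by simp
qed simp

lemma spread_inj:
  "0 < a \<Longrightarrow> spread a M j zs = spread a M j zs' \<Longrightarrow> zs = zs'"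
proof (induction zs arbitrary: j zs')
  case Nil
  then show ?case by (cases zs') auto
next
  case (Cons z zs)
  then obtain y ys where "zs' = y # ys" by (cases zs') auto
  then show ?case using Cons by auto
qed

lemma parts_differ_by_spread:
  assumes "sorted zs" "d \<le> a * M"
  shows "parts_differ_by d (mset (spread a M j zs))"
  using assms(1)
proof (induction zs arbitrary: j)
  case Nil
  then show ?case by (simp add: parts_differ_by_def)
next
  case (Cons z zs)
  define P where "P = mset (spread a M (Suc j) zs)"
  define u where "u = a * (z + M * j)"
  have far: "u + d \<le> x" if "x \<in># P" for x
  proof -
    have "a * (z + M * Suc j) \<le> x"
      using that Cons.prems by (intro spread_ge[of _ a M "Suc j" zs]) (auto simp: P_def)
    then show ?thesis using assms(2) by (simp add: u_def algebra_simps)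
  qed
  have P: "int d \<le> \<bar>int x - int y\<bar>" if "x \<in># P" "y \<in># P - {#x#}" for x y
    using Cons that by (simp add: P_def parts_differ_by_def)
  have "int d \<le> \<bar>int x - int y\<bar>" if "x \<in># add_mset u P" "y \<in># add_mset u P - {#x#}" for x y
  proof (cases "x = u")
    case True
    then have "y \<in># P" using that by simp
    then show ?thesis using far[of y] True by linarith
  next
    case False
    then have x: "x \<in># P" using that(1) by simp
    then have "y = u \<or> y \<in># P - {#x#}" using that(2) False by auto
    then show ?thesis using far[OF x] P[OF x] by fastforce
  qed
  then show ?case by (simp add: parts_differ_by_def P_def u_def)
qed

text \<open>Restored parts are positive and differ by at least \<open>M\<close>; scaling by
  \<open>a\<close> makes them at least \<open>a\<close>, with differences at least
  \<open>a * M\<close>.\<close>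

lemma card_gapless_le_q:
  assumes "0 < a" "d \<le> a * M"
  shows "card (gapless M b n) \<le> q d a (a * n)"
  unfolding q_def
proof (rule card_inj_on_le)
  define f where "f Z = mset (spread a M 0 (sorted_list_of_multiset Z))" for Z
  show "inj_on f (gapless M b n)"
  proof (rule inj_onI)
    fix Z Z' assume "f Z = f Z'"
    then have "spread a M 0 (sorted_list_of_multiset Z) = spread a M 0 (sorted_list_of_multiset Z')"
      unfolding f_def
      by (metis sorted_sorted_list_of_multiset sorted_spread properties_for_sort)
    then show "Z = Z'"
      using spread_inj[OF assms(1)] by (metis mset_sorted_list_of_multiset)
  qed
  show "f ` gapless M b n \<subseteq> {P \<in> partitions_of (a * n). (\<forall>x\<in>#P. a \<le> x) \<and> parts_differ_by d P}"
  proof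
    fix P assume "P \<in> f ` gapless M b n"
    then obtain Z where Z: "Z \<in> gapless M b n" "P = f Z" by auto
    define zs where "zs = sorted_list_of_multiset Z"
    have zs: "mset zs = Z" "sorted zs" by (simp_all add: zs_def)
    have "n = sum_list zs + M * (length zs choose 2)"
      using Z(1) by (simp add: gapless_def weight_def sum_mset_sum_list flip: zs(1))
    then have "sum_mset P = a * n"
      unfolding Z(2) f_def zs_def[symmetric] by (simp add: sum_mset_sum_list sum_list_spread)
    moreover have "a \<le> x" if "x \<in># P" for x
    proof -
      have "x \<in> set (spread a M 0 zs)" using that by (simp add: Z(2) f_def zs_def)
      moreover have "\<forall>z\<in>set zs. 1 \<le> z" using Z(1) by (auto simp: gapless_def zs_def Suc_le_eq)
      ultimately have "a * (1 + M * 0) \<le> x" by (rule spread_ge)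
      then show ?thesis by simp
    qed
    moreover have "parts_differ_by d P"
      using parts_differ_by_spread[OF zs(2) assms(2)] by (simp add: Z(2) f_def zs_def)
    ultimately show "P \<in> {P \<in> partitions_of (a * n). (\<forall>x\<in>#P. a \<le> x) \<and> parts_differ_by d P}"
      using assms(1) by (fastforce simp: partitions_of_def)
  qed
qed (simp add: finite_partitions_of)

section \<open>Dividing the parts counted by \<open>Q_mm\<close> by \<open>a\<close>\<close>

text \<open>Residues \<open>a\<close> and \<open>- a\<close> modulo \<open>a * m\<close> are
  \<open>a\<close> times the residues 1 and \<open>- 1\<close> modulo \<open>m\<close>. A quotient
  below \<open>m\<close> would be 1 or \<open>m - 1\<close>, giving a forbidden part.\<close>

lemma Q_mm_part_iff:
  assumes "d + 3 = a * m" "0 < a" "3 \<le> m" "0 < x"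
    "[int x = int a] (mod int (d + 3)) \<or> [int x = - int a] (mod int (d + 3))"
    "x \<noteq> a" "x \<noteq> d + 3 - a"
  shows "\<exists>y \<in> sparse_parts m. x = a * y"
proof -
  have "\<exists>y. x = a * y \<and> (y mod m = 1 \<or> y mod m = m - 1)"
    using assms(5)
  proof
    assume "[int x = int a] (mod int (d + 3))"
    then have "[x = a] (mod a * m)" unfolding assms(1) cong_int_iff .
    then have "x mod (a * m) = a mod (a * m)" unfolding cong_def .
    also have "\<dots> = a" using assms(2,3) by simp
    finally have "x = a * m * (x div (a * m)) + a" by (metis mult_div_mod_eq)
    then have "x = a * (m * (x div (a * m)) + 1)" by (simp add: algebra_simps)
    moreover have "(m * k + 1) mod m = 1" for k unfolding mod_mult_self4 using assms(3) by simp
    ultimately show ?thesis by blast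
  next
    assume "[int x = - int a] (mod int (d + 3))"
    then have "int (a * m) dvd int (x + a)" unfolding assms(1) by (simp add: cong_iff_dvd_diff)
    then have "a * m dvd x + a" unfolding int_dvd_int_iff .
    then obtain k where k: "x + a = a * (m * k)" by (auto simp: dvd_def mult.assoc)
    then have "k \<noteq> 0" using assms(4) by (intro notI) simp
    then obtain l where l: "k = Suc l" by (cases k) auto
    have "x = a * (m * l + (m - 1))" using k assms(3) unfolding l by (simp add: algebra_simps)
    moreover have "(m * l + (m - 1)) mod m = m - 1" unfolding mod_mult_self4 using assms(3) by simp
    ultimately show ?thesis by blast
  qed
  then obtain y where y: "x = a * y" "y mod m = 1 \<or> y mod m = m - 1" by blast
  have "m \<le> y"
  proof (rule ccontr)
    assume "\<not> m \<le> y"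
    then have "y = 1 \<or> y = m - 1" using y(2) by simp
    then show False using y(1) assms(1,6,7) by (auto simp: diff_mult_distrib2)
  qed
  then show ?thesis using y by (auto simp: sparse_parts_def)
qed

text \<open>All counted parts are multiples of \<open>a\<close>, so multiplication by
  \<open>a\<close> reaches every counted partition, and there is none unless \<open>a\<close>
  divides the sum.\<close>

lemma Q_mm_le:
  assumes "d + 3 = a * m" "0 < a" "3 \<le> m"
  shows "Q_mm d a (a * n) \<le> card {X \<in> partitions_of n. set_mset X \<subseteq> sparse_parts m}"
    and "\<not> a dvd N \<Longrightarrow> Q_mm d a N = 0"
proof -
  define A where "A N = {P \<in> partitions_of N. \<forall>x\<in>#P.
     ([int x = int a] (mod int (d + 3)) \<or> [int x = - int a] (mod int (d + 3))) \<and>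
     x \<noteq> a \<and> x \<noteq> d + 3 - a}" for N
  have A: "\<exists>X. P = image_mset ((*) a) X \<and> set_mset X \<subseteq> sparse_parts m" if "P \<in> A N" for P N
  proof -
    have *: "\<exists>y\<in>sparse_parts m. x = a * y" if "x \<in># P" for x
      using that \<open>P \<in> A N\<close> by (intro Q_mm_part_iff[OF assms]) (auto simp: A_def partitions_of_def)
    have "image_mset ((*) a) (image_mset (\<lambda>x. x div a) P) = image_mset id P"
      unfolding multiset.map_comp using * assms(2) by (intro image_mset_cong) force
    moreover have "set_mset (image_mset (\<lambda>x. x div a) P) \<subseteq> sparse_parts m"
      using * assms(2) by force
    ultimately show ?thesis by (metis multiset.map_id)
  qed
  have s: "sum_mset (image_mset ((*) a) X) = a * sum_mset X" for X
    by (induction X) (auto simp: algebra_simps)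
  have "A (a * n) \<subseteq> image_mset ((*) a) ` {X \<in> partitions_of n. set_mset X \<subseteq> sparse_parts m}"
  proof
    fix P assume P: "P \<in> A (a * n)"
    then obtain X where X: "P = image_mset ((*) a) X" "set_mset X \<subseteq> sparse_parts m" using A by blast
    have "sum_mset X = n" using P s[of X] assms(2) by (simp add: A_def partitions_of_def X(1))
    then show "P \<in> image_mset ((*) a) ` {X \<in> partitions_of n. set_mset X \<subseteq> sparse_parts m}"
      using X assms(3) by (fastforce simp: partitions_of_def sparse_parts_def)
  qed
  then show "Q_mm d a (a * n) \<le> card {X \<in> partitions_of n. set_mset X \<subseteq> sparse_parts m}"
    unfolding Q_mm_def A_def[symmetric]
    by (intro surj_card_le) (simp_all add: finite_partitions_of)
  assume N: "\<not> a dvd N"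
  have "A N = {}"
  proof (rule ccontr)
    assume "A N \<noteq> {}"
    then obtain P X where "P \<in> A N" "P = image_mset ((*) a) X" using A by blast
    then have "N = a * sum_mset X" using s[of X] by (simp add: A_def partitions_of_def)
    then show False using N by simp
  qed
  then show "Q_mm d a N = 0" unfolding Q_mm_def A_def[symmetric] by simp
qed

theorem theorem1p5:
  fixes a d n :: nat
  assumes "a \<ge> 3"
    and "d \<ge> 31 * a - 3"
    and "a dvd d + 3"
    and "n \<ge> 1"
  shows "Delta_mm d a n \<ge> 0"
proof -
  obtain m where m: "d + 3 = a * m" using assms(3) by (elim dvdE)
  have "a * 31 \<le> a * m" using assms(1,2) m by linarith
  then have m31: "31 \<le> m" using assms(1) by simp
  have "Q_mm d a n \<le> q d a n"
  proof (cases "a dvd n")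
    case True
    then obtain N where N: "n = a * N" by (elim dvdE)
    obtain M where M: "m \<le> M" "card {X \<in> partitions_of N. set_mset X \<subseteq> sparse_parts m} \<le>
        card (gapless M (Suc M) N)"
      using ex_gap[OF m31] by blast
    have "d \<le> a * M" using m mult_le_mono2[OF M(1), of a] by linarith
    then have "card (gapless M (Suc M) N) \<le> q d a n"
      using card_gapless_le_q assms(1) by (simp add: N)
    moreover have "Q_mm d a n \<le> card {X \<in> partitions_of N. set_mset X \<subseteq> sparse_parts m}"
      unfolding N using Q_mm_le(1)[OF m] assms(1) m31 by simp
    ultimately show ?thesis using M(2) by linarith
  next
    case False
    then show ?thesis using Q_mm_le(2)[OF m] assms(1) m31 by simp
  qed
  then show ?thesis by (simp add: Delta_mm_def)
qed

end
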